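(* Let $n\ge2$ be an integer and let $0<C<+\infty$. For $R\neq0$ let $g_R$ be the solution of $$\frac{g''}{1+(g')^2}=\Big(\frac r2-\frac{n-1}{r}\Big)g'-\frac g2,\qquad g(R)=0,\quad g'(R)=C,$$ let $L_1$ be the curve of horizontal points $(\bar R,g_R(\bar R))$ of the solutions $g_R$ with $R\in(-\infty,-\sqrt{2n})$, and let $L_2$ be the curve of horizontal points of the solutions $g_R$ with $R\in(0,\sqrt{2(n-1)})$. (a) Put $$r_{L_1}=-\sqrt{2(n-1)+1+\sqrt{8(n-1)+1}}\;<\;-\sqrt{2(n-1)} .$$ Then $L_1$ is monotone increasing when $r<r_{L_1}$, i.e. $L_1$ is monotone increasing at every $R\in(-\infty,-\sqrt{2n})$ with $\bar R<r_{L_1}$. Moreover, $L_1$ intersects the line $r=r_{L_1}$ at exactly one point. The same conclusions also hold when $C=+\infty$. (b) Let $n\ge3$ and put $r_{L_2}=\min\{r_1,r_2,r_3\}$, where $$r_1=\sqrt{2\Big[n-\tfrac12-\sqrt{2n-\tfrac74}\Big]},$$ $$r_2=\sqrt{2\Big[\frac{(n-1)(4n-5)}{2(2n-3)}-(n-1)\sqrt{\Big(\frac{4n-5}{4n-6}\Big)^2-1}\Big]},$$ $$r_3=\sqrt{2(n-1)\frac{n-2}{n}},$$ so that $0<r_{L_2}<\sqrt{2(n-1)}$. Then $L_2$ is monotone increasing when $0<r<r_{L_2}$, i.e. $L_2$ is monotone increasing at every $R\in(0,\sqrt{2(n-1)})$ with $0<\bar R<r_{L_2}$. Moreover, $L_2$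 intersects the line $r=r_{L_2}$ at exactly one point. The same conclusions also hold when $C=+\infty$.
   Context: The equation is that of profile curves $x=g(r)$ of rotationally symmetric self-shrinkers in $\mathbb R^{n+1}$ (rotation about the $x$-axis); it is also considered for $r<0$ by formal extension (it is invariant under $r\mapsto-r$). The initial condition $g'(R)=+\infty$ (case $C=+\infty$) means that $g$ is defined to the right of $R$, is continuous at $R$, and $g'(r)\to+\infty$ as $r\to R^+$. Only the portion $r\ge R$ (for $R<0$, inside $r<0$) of a solution starting at $R$ on which $g\ge0$ and $g'\ge0$ is considered. A horizontal point of $g$ is a point of its graph where $g'=0$. The horizontal point of $g_R$ ending the portion just described is denoted $(\bar R,g_R(\bar R))$ (first entry: the $r$-coordinate; second entry: the $x$-coordinate), with $\bar R>R$, $g_R'(\bar R)=0$. The curves $L_1$ and $L_2$ depend on the initial slope $C\in(0,+\infty]$. Monotonicity: $L_1$ is called monotone increasing at $R\in(-\infty,-\sqrt{2n})$ if there is an interval $I_R\subset(-\infty,-\sqrt{2n})$ containing $R$ (a neighbourhood of $R$) such that for all $R_1,R_2\in I_R$, $$R_2>R_1\ \Rightarrow\ \bar R_2>\bar R_1\ \text{ and }\ g_{R_2}(\bar R_2)>g_{R_1}(\bar R_1).$$ The definition for $L_2$ is the same with $(-\infty,-\sqrt{2n})$ replaced by $(0,\sqrt{2(n-1)})$. *)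

theory Defs
  imports "HOL-Analysis.Analysis"
begin

text \<open>Profile curves \<open>x = g(r)\<close> of rotationally symmetric self-shrinkers. The function \<open>p\<close> is the
  slope \<open>g'\<close>; derivatives are taken within \<open>I\<close>, hence are one-sided at end points
  belonging to \<open>I\<close>.\<close>

definition shrinker_solution_on ::
    "nat \<Rightarrow> real set \<Rightarrow> (real \<Rightarrow> real) \<Rightarrow> (real \<Rightarrow> real) \<Rightarrow> bool" where
  "shrinker_solution_on n I g p \<longleftrightarrow>
     (\<forall>r\<in>I. (g has_real_derivative p r) (at r within I) \<and>
       (\<exists>q. (p has_real_derivative q) (at r within I) \<and>
         q / (1 + (p r)\<^sup>2) = (r / 2 - (real n - 1) / r) * p r - g r / 2))"

text \<open>The solution on the interval from \<open>R\<close> to \<open>b\<close> with \<open>g R = 0\<close> and initial slope \<open>C\<close>.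
  If \<open>C = \<infinity>\<close>, the slope \<open>p R\<close> at \<open>R\<close> itself is meaningless: the equation is
  required only to the right of \<open>R\<close>.\<close>

definition shrinker_ivp ::
    "nat \<Rightarrow> ereal \<Rightarrow> real \<Rightarrow> real \<Rightarrow> (real \<Rightarrow> real) \<Rightarrow> (real \<Rightarrow> real) \<Rightarrow> bool" where
  "shrinker_ivp n C R b g p \<longleftrightarrow> g R = 0 \<and>
     (if C = \<infinity>
      then shrinker_solution_on n {R<..b} g p \<and> continuous_on {R..b} g \<and>
           filterlim p at_top (at_right R)
      else shrinker_solution_on n {R..b} g p \<and> ereal (p R) = C)"

text \<open>\<open>horizontal_point n C R (\<rho>, h)\<close>: the solution started at \<open>R\<close> satisfies
  \<open>g \<ge> 0\<close> and \<open>g' \<ge> 0\<close> up to \<open>\<rho>\<close>, where \<open>g' = 0\<close> and \<open>g = h\<close>. At such a point \<open>g'' = - h / 2 < 0\<close>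
  (for \<open>C > 0\<close>), so it is the first zero of \<open>g'\<close>, and the portion with \<open>g' \<ge> 0\<close> does end there.
  Not every solution is claimed to have a horizontal point, hence a relation instead of a function of \<open>R\<close>.\<close>

definition horizontal_point :: "nat \<Rightarrow> ereal \<Rightarrow> real \<Rightarrow> real \<times> real \<Rightarrow> bool" where
  "horizontal_point n C R = (\<lambda>(\<rho>, h).
     R < \<rho> \<and> (R < 0 \<longrightarrow> \<rho> < 0) \<and>
     (\<exists>g p. shrinker_ivp n C R \<rho> g p \<and>
            (\<forall>r\<in>{R<..\<rho>}. 0 \<le> g r \<and> 0 \<le> p r) \<and>
            p \<rho> = 0 \<and> g \<rho> = h))"

definition horizontal_curve :: "nat \<Rightarrow> ereal \<Rightarrow> real set \<Rightarrow> (real \<times> real) set" where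
  "horizontal_curve n C D = {P. \<exists>R\<in>D. horizontal_point n C R P}"

definition L1_dom :: "nat \<Rightarrow> real set" where
  "L1_dom n = {..< - sqrt (2 * real n)}"

definition L2_dom :: "nat \<Rightarrow> real set" where
  "L2_dom n = {0 <..< sqrt (2 * (real n - 1))}"

text \<open>The neighbourhood \<open>I\<close> is required to consist of starting points whose
  solutions do have a horizontal point.\<close>

definition monotone_increasing_at :: "nat \<Rightarrow> ereal \<Rightarrow> real set \<Rightarrow> real \<Rightarrow> bool" where
  "monotone_increasing_at n C D R \<longleftrightarrow>
     (\<exists>I. open I \<and> is_interval I \<and> R \<in> I \<and> I \<subseteq> D \<and>
        (\<forall>R'\<in>I. \<exists>P. horizontal_point n C R' P) \<and>
        (\<forall>R1\<in>I. \<forall>R2\<in>I. \<forall>\<rho>1 h1 \<rho>2 h2.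
           R1 < R2 \<longrightarrow> horizontal_point n C R1 (\<rho>1, h1) \<longrightarrow> horizontal_point n C R2 (\<rho>2, h2) \<longrightarrow>
           \<rho>1 < \<rho>2 \<and> h1 < h2))"

definition r_L1 :: "nat \<Rightarrow> real" where
  "r_L1 n = - sqrt (2 * (real n - 1) + 1 + sqrt (8 * (real n - 1) + 1))"

definition r_1 :: "nat \<Rightarrow> real" where
  "r_1 n = sqrt (2 * (real n - 1 / 2 - sqrt (2 * real n - 7 / 4)))"

definition r_2 :: "nat \<Rightarrow> real" where
  "r_2 n = sqrt (2 * ((real n - 1) * (4 * real n - 5) / (2 * (2 * real n - 3))
             - (real n - 1) * sqrt (((4 * real n - 5) / (4 * real n - 6))\<^sup>2 - 1)))"

definition r_3 :: "nat \<Rightarrow> real" where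
  "r_3 n = sqrt (2 * (real n - 1) * ((real n - 2) / real n))"

definition r_L2 :: "nat \<Rightarrow> real" where
  "r_L2 n = Min {r_1 n, r_2 n, r_3 n}"

end

theory Submission
  imports Defs
begin

text \<open>Write \<open>b(r) = (n-1)/r - r/2\<close> and \<open>A = -b'\<close>. Left of \<open>r_L1\<close>, and on \<open>(0, r_L2]\<close>
  since \<open>r_L2 \<le> r_1\<close>, one has \<open>b > 0\<close> and \<open>A \<le> b\<^sup>2\<close>. There a profile curve turns monotonically, so
  it can be parametrised by the angle \<open>t = \<pi>/2 - arctan g'\<close>, which makes the equation
  \<open>r' = sin t / \<kappa>\<close>, \<open>x' = cos t / \<kappa>\<close> with \<open>\<kappa> = b(r) cos t + x sin t / 2\<close>. All solutions
  with initial slope \<open>C\<close> live on the same interval \<open>[t0, \<pi>/2]\<close>, the case \<open>C = \<infinity>\<close> (\<open>t0 = 0\<close>) is regular, and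
  the horizontal point is the value at \<open>\<pi>/2\<close>.

  Let \<open>F' = b F\<close> and \<open>G' = F\<close>. For two solutions with \<open>R1 < R2\<close> the difference of
  \<open>K = cos t * F(r) / x + sin t / 2 * G(r)\<close> is positive near \<open>t0\<close>, because \<open>b F\<close> is increasing, and
  cannot return to \<open>0\<close> while \<open>r1 < r2\<close>, because \<open>F / (x\<^sup>2 \<kappa>)\<close> decreases along the level curves
  of \<open>K\<close>; both facts use \<open>A \<le> b\<^sup>2\<close>. As \<open>x1 < x2\<close>, a first time with \<open>r1 = r2\<close> would make the
  difference nonpositive. Hence horizontal points to the left of the line are strictly ordered in
  both coordinates. Picard iteration for a truncated Lipschitz system, continuous dependence on \<open>R\<close>
  and the intermediate value theorem yield the point on the line.\<close>

section \<open>Differential equations and monotonicity on the real line\<close>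

text \<open>The obstacle is that \<open>r\<close> and \<open>x\<close> act on
  \<open>r' = sin t / \<kappa>\<close> in opposite directions: a larger \<open>r\<close> lowers
  \<open>b(r)\<close>, hence \<open>\<kappa>\<close>, and speeds \<open>r\<close> up, while a larger
  \<open>x\<close> raises \<open>\<kappa>\<close> and slows \<open>r\<close> down. A start further
  right makes both larger, so the order of the radii does not propagate by itself. The order of the
  heights does: in \<open>x' = cos t / \<kappa>\<close> a larger \<open>r\<close> helps and a larger
  \<open>x\<close> only damps. \<open>F\<close> is the weight \<open>|r|^(n-1) exp(-r^2/4)\<close>,
  which puts the profile equation into divergence form,
  \<open>d(F cos t)/dr = - F x sin t / 2\<close>. The quantity \<open>K\<close> is built from this
  conserved form, and its difference for two solutions replaces the missing comparison of the radii.
  The angle is a parameter only where \<open>\<kappa> > 0\<close> is known, that is, inside the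
  region. Anything that crosses the line is therefore stopped on it and examined there.\<close>

lemma lipschitz_ivp_solution:
  fixes f :: "real \<Rightarrow> 'a::banach \<Rightarrow> 'a"
  assumes ab: "a \<le> b"
    and cont: "\<And>v. continuous_on {a..b} v \<Longrightarrow> continuous_on {a..b} (\<lambda>t. f t (v t))"
    and lip: "\<And>t u v. t \<in> {a..b} \<Longrightarrow> norm (f t u - f t v) \<le> L * norm (u - v)"
  obtains u where "u a = u0"
    "\<And>t. t \<in> {a..b} \<Longrightarrow> (u has_vector_derivative f t (u t)) (at t within {a..b})"
proof -
  \<comment> \<open>The Picard operator is considered for \<open>u\<close> multiplied by
    \<open>exp (- k * (t - a))\<close>. In this weighted sup norm its Lipschitz constant is at most
    \<open>\<bar>L\<bar> / k \<le> 1/2\<close>, so one fixed point covers the whole interval and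
    nothing has to be glued.\<close>
  define k where "k = 2 * \<bar>L\<bar> + 1"
  have k: "k > 0" "\<bar>L\<bar> / k \<le> 1/2" by (auto simp: k_def field_simps)
  \<comment> \<open>Clamping the time to \<open>{a..b}\<close> turns functions on the interval into
    bounded continuous functions on the line, which form a complete space. \<open>y\<close> below
    undoes the exponential weight.\<close>
  define c where "c t = max a (min b t)" for t
  have c: "c t \<in> {a..b}" for t using ab by (auto simp: c_def)
  have c_id: "c t = t" if "t \<in> {a..b}" for t using that by (auto simp: c_def)
  have c_cont: "continuous_on UNIV c" unfolding c_def by (intro continuous_intros)
  define y where "y v s = exp (k * (s - a)) *\<^sub>R v s" for v :: "real \<Rightarrow> 'a" and s
  have fy: "continuous_on {a..b} (\<lambda>s. f s (y v s))" if "continuous_on {a..b} v" for v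
    unfolding y_def by (intro cont continuous_intros that)
  define h where "h v t = exp (- k * (t - a)) *\<^sub>R (u0 + integral {a..t} (\<lambda>s. f s (y v s)))" for v t
  have h_cont: "continuous_on {a..b} (h v)" if "continuous_on {a..b} v" for v
    unfolding h_def
    by (intro continuous_intros indefinite_integral_continuous_1 integrable_continuous_real fy that)
  have hc: "(\<lambda>t. h v (c t)) \<in> bcontfun" if "continuous_on {a..b} v" for v
  proof -
    have "continuous_on UNIV (\<lambda>t. h v (c t))"
      by (rule continuous_on_compose2[OF h_cont[OF that] c_cont]) (use c in auto)
    moreover have "bounded (range (\<lambda>t. h v (c t)))"
      by (rule bounded_subset[OF compact_imp_bounded[OF compact_continuous_image[OF h_cont[OF that]]]])
        (use c in auto)
    ultimately show ?thesis by (simp add: bcontfun_def)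
  qed
  define J where "J v = Bcontfun (\<lambda>t. h (apply_bcontfun v) (c t))" for v :: "real \<Rightarrow>\<^sub>C 'a"
  have J: "apply_bcontfun (J v) t = h (apply_bcontfun v) (c t)" for v t
    unfolding J_def by (subst Bcontfun_inverse) (auto intro!: hc)
  have contr: "dist (J v) (J w) \<le> 1/2 * dist v w" for v w
  proof (rule dist_bound)
    fix t
    define \<tau> where "\<tau> = c t"
    have \<tau>: "a \<le> \<tau>" "\<tau> \<le> b" using c[of t] by (auto simp: \<tau>_def)
    define d where "d = dist v w"
    have sub: "continuous_on {a..\<tau>} (\<lambda>s. f s (y (apply_bcontfun z) s))" for z
      by (rule continuous_on_subset[OF fy]) (use \<tau> in auto)
    have I1: "((\<lambda>s. \<bar>L\<bar> * (exp (k * (s - a)) * d)) has_integral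
        \<bar>L\<bar> * (exp (k * (\<tau> - a)) / k * d) - \<bar>L\<bar> * (exp (k * (a - a)) / k * d)) {a..\<tau>}"
      by (rule fundamental_theorem_of_calculus)
        (use \<tau> k in \<open>auto intro!: derivative_eq_intros simp flip: has_real_derivative_iff_has_vector_derivative\<close>)
    have "norm (integral {a..\<tau>} (\<lambda>s. f s (y v s) - f s (y w s)))
        \<le> integral {a..\<tau>} (\<lambda>s. \<bar>L\<bar> * (exp (k * (s - a)) * d))"
    proof (rule integral_norm_bound_integral)
      show "(\<lambda>s. f s (y v s) - f s (y w s)) integrable_on {a..\<tau>}"
        by (intro integrable_continuous_real continuous_intros sub)
      show "(\<lambda>s. \<bar>L\<bar> * (exp (k * (s - a)) * d)) integrable_on {a..\<tau>}" using I1 by blast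
      fix s assume s: "s \<in> {a..\<tau>}"
      have "norm (f s (y v s) - f s (y w s)) \<le> L * norm (y v s - y w s)"
        by (rule lip) (use s \<tau> in auto)
      also have "y v s - y w s = exp (k * (s - a)) *\<^sub>R (v s - w s)"
        by (simp add: y_def scaleR_diff_right)
      also have "L * norm \<dots> \<le> \<bar>L\<bar> * (exp (k * (s - a)) * d)"
        unfolding d_def using dist_bounded[of v s w]
        by (auto simp: dist_norm intro!: mult_mono)
      finally show "norm (f s (y v s) - f s (y w s)) \<le> \<bar>L\<bar> * (exp (k * (s - a)) * d)" .
    qed
    also have "\<dots> = \<bar>L\<bar> / k * d * (exp (k * (\<tau> - a)) - 1)"
      unfolding integral_unique[OF I1] using k(1) by (simp add: field_simps)
    finally have le: "norm (integral {a..\<tau>} (\<lambda>s. f s (y v s)) - integral {a..\<tau>} (\<lambda>s. f s (y w s)))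
        \<le> \<bar>L\<bar> / k * d * (exp (k * (\<tau> - a)) - 1)"
      by (subst (asm) integral_diff) (auto intro!: integrable_continuous_real sub)
    have "dist (J v t) (J w t) = exp (- k * (\<tau> - a)) *
        norm (integral {a..\<tau>} (\<lambda>s. f s (y v s)) - integral {a..\<tau>} (\<lambda>s. f s (y w s)))"
      unfolding J dist_norm h_def \<tau>_def[symmetric]
      by (simp flip: scaleR_diff_right)
    also have "\<dots> \<le> exp (- k * (\<tau> - a)) * (\<bar>L\<bar> / k * d * (exp (k * (\<tau> - a)) - 1))"
      using le by (intro mult_left_mono) auto
    also have "\<dots> = \<bar>L\<bar> / k * d * (1 - exp (- k * (\<tau> - a)))"
      by (simp add: algebra_simps flip: exp_add)
    also have "\<dots> \<le> \<bar>L\<bar> / k * d * 1"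
      using k by (intro mult_left_mono) (auto simp: d_def)
    also have "\<dots> \<le> 1/2 * d"
      using mult_right_mono[OF k(2), of d] by (simp add: d_def)
    finally show "dist (J v t) (J w t) \<le> 1/2 * dist v w" by (simp add: d_def)
  qed
  have "\<exists>!v. J v = v" by (rule banach_fix_type[of "1/2"]) (use contr in auto)
  then obtain v where v: "J v = v" by blast
  define u where "u t = y v t" for t
  have u_eq: "u t = u0 + integral {a..t} (\<lambda>s. f s (u s))" if "t \<in> {a..b}" for t
  proof -
    have "v t = h v t" using J[of v t] v c_id[OF that] by simp
    then show ?thesis unfolding u_def by (simp add: y_def h_def flip: exp_add)
  qed
  have fu: "continuous_on {a..b} (\<lambda>s. f s (u s))" unfolding u_def by (rule fy) simp
  show ?thesis
  proof
    show "u a = u0" using u_eq[of a] ab by simp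
    fix t assume t: "t \<in> {a..b}"
    have "((\<lambda>t. u0 + integral {a..t} (\<lambda>s. f s (u s))) has_vector_derivative f t (u t)) (at t within {a..b})"
      using integral_has_vector_derivative[OF fu t]
      by (auto intro!: derivative_eq_intros)
    then show "(u has_vector_derivative f t (u t)) (at t within {a..b})"
      using t u_eq by (rule has_vector_derivative_transform[rotated 2]) auto
  qed
qed

text \<open>\<open>exp (- 2 * L * t)\<close> times the squared norm of \<open>d\<close> is
  decreasing. The square is differentiable also where \<open>d\<close> vanishes. The bound serves
  both for uniqueness and for continuous dependence on the starting point.\<close>

lemma gronwall_norm:
  fixes d :: "real \<Rightarrow> 'a::real_inner"
  assumes "a \<le> b" and cont: "continuous_on {a..b} d"
    and der: "\<And>t. t \<in> {a<..<b} \<Longrightarrow> (d has_vector_derivative d' t) (at t)"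
    and le: "\<And>t. t \<in> {a<..<b} \<Longrightarrow> norm (d' t) \<le> L * norm (d t)"
  shows "norm (d b) \<le> exp (L * (b - a)) * norm (d a)"
proof -
  define h where "h t = exp (- 2 * L * t) * (d t \<bullet> d t)" for t
  have "h b \<le> h a"
  proof (rule DERIV_nonpos_imp_decreasing_open[OF \<open>a \<le> b\<close>])
    show "continuous_on {a..b} h" unfolding h_def by (intro continuous_intros cont)
    fix t assume t: "a < t" "t < b"
    have "(d has_derivative (\<lambda>x. x *\<^sub>R d' t)) (at t)"
      using der[of t] t by (simp add: has_vector_derivative_def)
    then have "((\<lambda>t. d t \<bullet> d t) has_derivative (\<lambda>x. d t \<bullet> (x *\<^sub>R d' t) + (x *\<^sub>R d' t) \<bullet> d t)) (at t)"
      by (intro has_derivative_inner)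
    then have "((\<lambda>t. d t \<bullet> d t) has_real_derivative 2 * (d t \<bullet> d' t)) (at t)"
      by (rule has_derivative_imp_has_field_derivative) (simp add: inner_commute algebra_simps)
    then have 1: "(h has_real_derivative exp (- 2 * L * t) * (2 * (d t \<bullet> d' t) - 2 * L * (d t \<bullet> d t))) (at t)"
      unfolding h_def by (auto intro!: derivative_eq_intros simp: algebra_simps)
    have "d t \<bullet> d' t \<le> norm (d t) * norm (d' t)" by (rule norm_cauchy_schwarz)
    also have "\<dots> \<le> norm (d t) * (L * norm (d t))" using le[of t] t by (intro mult_left_mono) auto
    also have "\<dots> = L * (d t \<bullet> d t)" by (simp add: dot_square_norm power2_eq_square)
    finally have "exp (- 2 * L * t) * (2 * (d t \<bullet> d' t) - 2 * L * (d t \<bullet> d t)) \<le> 0"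
      by (simp add: mult_nonneg_nonpos)
    with 1 show "\<exists>y. (h has_real_derivative y) (at t) \<and> y \<le> 0" by blast
  qed
  then have "exp (2 * L * b) * h b \<le> exp (2 * L * b) * h a" by simp
  then have "(norm (d b))\<^sup>2 \<le> (exp (L * (b - a)) * norm (d a))\<^sup>2"
    by (simp add: h_def dot_square_norm power_mult_distrib algebra_simps flip: exp_add exp_double mult.assoc)
  then show ?thesis by (rule power2_le_imp_le) auto
qed

lemma first_nonpos_point:
  fixes f :: "real \<Rightarrow> real"
  assumes cont: "continuous_on {a..b} f" and "0 < f a" and "t \<in> {a..b}" "f t \<le> 0"
  obtains s where "s \<in> {a<..t}" "f s = 0" "\<And>u. u \<in> {a..<s} \<Longrightarrow> 0 < f u"
proof -
  define S where "S = {u \<in> {a..b}. f u \<le> 0}"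
  have "S = {a..b} \<inter> f -` {..0}" by (auto simp: S_def)
  then have "closed S" by (simp add: continuous_closed_preimage[OF cont])
  moreover have "t \<in> S" "bdd_below S"
    using assms by (auto simp: S_def intro!: bdd_belowI[of _ a])
  ultimately have S: "closed S" "t \<in> S" "bdd_below S" by auto
  define s where "s = Inf S"
  have sS: "s \<in> S" unfolding s_def by (rule closed_contains_Inf) (use S in auto)
  have st: "s \<le> t" unfolding s_def by (rule cInf_lower) (use S in auto)
  have pos: "0 < f u" if "u \<in> {a..<s}" for u
  proof (rule ccontr)
    assume "\<not> 0 < f u"
    then have "u \<in> S" using that sS by (auto simp: S_def)
    then have "s \<le> u" unfolding s_def using S by (intro cInf_lower) auto
    then show False using that by simp
  qed
  have as: "a < s" using sS \<open>0 < f a\<close> by (auto simp: S_def order.order_iff_strict)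
  have "f s = 0"
  proof (rule ccontr)
    assume "f s \<noteq> 0"
    then have "f s < 0" using sS by (auto simp: S_def)
    then obtain u where "a \<le> u" "u \<le> s" "f u = 0"
      using IVT2'[of f s 0 a] as assms(2) continuous_on_subset[OF cont, of "{a..s}"] sS by (auto simp: S_def)
    then show False using pos[of u] \<open>f s < 0\<close> by (cases "u = s") auto
  qed
  then show ?thesis using that[of s] as st pos by auto
qed

text \<open>A positive derivative at the first zero would make \<open>f\<close> negative just before
  it. The sign of the derivative is asked for only at zeros of \<open>f\<close>, which is all that
  the level curves of \<open>K\<close> supply later.\<close>

lemma positive_if_deriv_pos_at_zeros:
  fixes f :: "real \<Rightarrow> real"
  assumes cont: "continuous_on {a..b} f" and "0 < f a"
    and der: "\<And>t. t \<in> {a<..b} \<Longrightarrow> f t = 0 \<Longrightarrow> \<exists>y>0. (f has_real_derivative y) (at t within {a..b})"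
    and t: "t \<in> {a..b}"
  shows "0 < f t"
proof (rule ccontr)
  assume "\<not> 0 < f t"
  then obtain s where s: "s \<in> {a<..t}" "f s = 0" "\<And>u. u \<in> {a..<s} \<Longrightarrow> 0 < f u"
    using first_nonpos_point[OF cont \<open>0 < f a\<close> t] by (metis not_less)
  then obtain y where y: "y > 0" "(f has_real_derivative y) (at s within {a..b})"
    using der[of s] t by auto
  from has_real_derivative_pos_inc_left[OF y(2,1)] obtain d where
    d: "d > 0" "\<And>h. 0 < h \<Longrightarrow> s - h \<in> {a..b} \<Longrightarrow> h < d \<Longrightarrow> f (s - h) < f s" by blast
  define h where "h = min (d / 2) (s - a)"
  have "f (s - h) < f s" by (rule d) (use d s t in \<open>auto simp: h_def\<close>)
  moreover have "0 < f (s - h)" by (rule s(3)) (use d s in \<open>auto simp: h_def\<close>)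
  ultimately show False using s by simp
qed

text \<open>The difference quotient of \<open>g\<close> is the reciprocal of that of
  \<open>f\<close>, along any set. This form also covers end points of an interval, where the
  profile equation is understood with one-sided derivatives.\<close>

lemma DERIV_inverse_within:
  fixes f g :: "real \<Rightarrow> real"
  assumes der: "(f has_real_derivative D) (at s within S)" and "D \<noteq> 0"
    and inj: "inj_on f S" and "s \<in> S"
    and g: "\<And>x. x \<in> S \<Longrightarrow> g (f x) = x"
    and cont: "continuous (at (f s) within f ` S) g"
  shows "(g has_real_derivative inverse D) (at (f s) within f ` S)"
proof -
  have gs: "g (f s) = s" using g \<open>s \<in> S\<close> by auto
  have lim: "filterlim g (at s within S) (at (f s) within f ` S)"
    unfolding filterlim_at
  proof
    show "(g \<longlongrightarrow> s) (at (f s) within f ` S)" using cont gs by (simp add: continuous_within)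
    show "\<forall>\<^sub>F y in at (f s) within f ` S. g y \<in> S \<and> g y \<noteq> s"
      unfolding eventually_at_filter using g by (auto intro!: always_eventually)
  qed
  have "((\<lambda>x. (f x - f s) / (x - s)) \<longlongrightarrow> D) (at s within S)"
    using der by (simp add: has_field_derivative_iff)
  from filterlim_compose[OF this lim]
  have "((\<lambda>y. (f (g y) - f s) / (g y - s)) \<longlongrightarrow> D) (at (f s) within f ` S)" .
  from tendsto_inverse[OF this \<open>D \<noteq> 0\<close>]
  have "((\<lambda>y. (g y - s) / (f (g y) - f s)) \<longlongrightarrow> inverse D) (at (f s) within f ` S)"
    by (simp add: inverse_eq_divide)
  moreover have "\<forall>\<^sub>F y in at (f s) within f ` S. (g y - s) / (f (g y) - f s) = (g y - g (f s)) / (y - f s)"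
    unfolding eventually_at_filter using g gs by (auto intro!: always_eventually)
  ultimately show ?thesis
    unfolding has_field_derivative_iff by (rule Lim_transform_eventually)
qed

lemma continuous_on_pos_nearby:
  fixes f :: "real \<Rightarrow> real"
  assumes "continuous_on S f" "a \<in> S" "0 < f a"
  obtains d where "d > 0" "\<And>t. t \<in> S \<Longrightarrow> \<bar>t - a\<bar> < d \<Longrightarrow> 0 < f t"
proof -
  obtain d where d: "d > 0" "\<And>t. t \<in> S \<Longrightarrow> dist t a < d \<Longrightarrow> dist (f t) (f a) < f a"
    using assms unfolding continuous_on_iff by metis
  show ?thesis
    by (rule that[OF d(1)]) (use d(2) in \<open>force simp: dist_real_def\<close>)
qed

lemma integral_has_real_derivative_at:
  fixes f :: "real \<Rightarrow> real"
  assumes "continuous_on {a..b} f" "t \<in> {a<..<b}"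
  shows "((\<lambda>u. integral {a..u} f) has_real_derivative f t) (at t)"
proof -
  have "t \<in> {a..b}" "at t within {a..b} = at t"
    using assms(2) by (auto simp: at_within_Icc_at)
  then show ?thesis using integral_has_real_derivative[OF assms(1)] by metis
qed

section \<open>Profile curves parametrised by the turning angle\<close>

text \<open>\<open>D\<close> is an interval with right end \<open>e\<close>, the line in question;
  the instances are \<open>{..e}\<close> and \<open>{0<..e}\<close>. The strict inequality between
  \<open>A\<close> and \<open>b\<^sup>2\<close> is asked only left of \<open>e\<close>, because at
  the extreme position of the line equality holds. \<open>F_small\<close> describes the open end of
  \<open>D\<close>: starting points far enough to the left give solutions that are horizontal before
  reaching \<open>e\<close>.\<close>

locale shrinker_region =
  fixes b A F :: "real \<Rightarrow> real" and D :: "real set" and e :: real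
  assumes e_in: "e \<in> D"
    and le_e: "\<And>r. r \<in> D \<Longrightarrow> r \<le> e"
    and upward: "\<And>r r'. r \<in> D \<Longrightarrow> r \<le> r' \<Longrightarrow> r' \<le> e \<Longrightarrow> r' \<in> D"
    and open_D: "open (D - {e})"
    and b_pos: "\<And>r. r \<in> D \<Longrightarrow> 0 < b r"
    and b_deriv: "\<And>r. r \<in> D \<Longrightarrow> (b has_real_derivative - A r) (at r)"
    and A_pos: "\<And>r. r \<in> D \<Longrightarrow> 0 < A r"
    and A_cont: "continuous_on D A"
    and A_le: "\<And>r. r \<in> D \<Longrightarrow> A r \<le> (b r)\<^sup>2"
    and A_less: "\<And>r. r \<in> D \<Longrightarrow> r < e \<Longrightarrow> A r < (b r)\<^sup>2"
    and F_pos: "\<And>r. r \<in> D \<Longrightarrow> 0 < F r"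
    and F_deriv: "\<And>r. r \<in> D \<Longrightarrow> (F has_real_derivative b r * F r) (at r)"
    and F_small: "\<And>r d. r \<in> D \<Longrightarrow> 0 < d \<Longrightarrow> \<exists>R\<in>D. R < r \<and> F R * (b R + 1) < d"
begin

definition curv :: "real \<Rightarrow> real \<Rightarrow> real \<Rightarrow> real" where
  "curv t r x = b r * cos t + x * sin t / 2"

text \<open>Derivatives are required only inside the interval, so that a solution read off from a
  graph owes nothing at its ends. The end \<open>t1\<close> is free because solutions are also
  considered only up to the angle at which they meet \<open>e\<close>.\<close>

definition angle_solution ::
    "real \<Rightarrow> real \<Rightarrow> real \<Rightarrow> (real \<Rightarrow> real) \<Rightarrow> (real \<Rightarrow> real) \<Rightarrow> bool" where
  "angle_solution t0 t1 R r x \<longleftrightarrow>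
     continuous_on {t0..t1} r \<and> continuous_on {t0..t1} x \<and> r t0 = R \<and> x t0 = 0 \<and>
     (\<forall>t\<in>{t0..t1}. r t \<in> D) \<and> (\<forall>t\<in>{t0<..t1}. 0 < x t) \<and>
     (\<forall>t\<in>{t0<..<t1}. (r has_real_derivative sin t / curv t (r t) (x t)) (at t) \<and>
                      (x has_real_derivative cos t / curv t (r t) (x t)) (at t))"

lemma b_cont: "continuous_on D b"
  by (rule DERIV_continuous_on[OF has_field_derivative_at_within[OF b_deriv]])

lemma F_cont: "continuous_on D F"
  by (rule DERIV_continuous_on[OF has_field_derivative_at_within[OF F_deriv]])

lemma between_in_D: "r1 \<in> D \<Longrightarrow> r2 \<in> D \<Longrightarrow> r1 \<le> r \<Longrightarrow> r \<le> r2 \<Longrightarrow> r \<in> D"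
  using upward le_e by (meson order_trans)

lemma b_strict_decreasing:
  assumes "r1 \<in> D" "r2 \<in> D" "r1 < r2"
  shows "b r2 < b r1"
proof (rule DERIV_neg_imp_decreasing[OF \<open>r1 < r2\<close>])
  fix r assume "r1 \<le> r" "r \<le> r2"
  then have "r \<in> D" by (rule between_in_D[OF assms(1,2)])
  then show "\<exists>y. (b has_real_derivative y) (at r) \<and> y < 0"
    using b_deriv A_pos by (intro exI[of _ "- A r"]) simp
qed

lemma b_decreasing: "r1 \<in> D \<Longrightarrow> r2 \<in> D \<Longrightarrow> r1 \<le> r2 \<Longrightarrow> b r2 \<le> b r1"
  using b_strict_decreasing by (cases "r1 = r2") (auto simp: less_le)

lemma F_strict_increasing:
  assumes "r1 \<in> D" "r2 \<in> D" "r1 < r2"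
  shows "F r1 < F r2"
proof (rule DERIV_pos_imp_increasing[OF \<open>r1 < r2\<close>])
  fix r assume "r1 \<le> r" "r \<le> r2"
  then have "r \<in> D" by (rule between_in_D[OF assms(1,2)])
  then show "\<exists>y. (F has_real_derivative y) (at r) \<and> 0 < y"
    using F_deriv b_pos F_pos by (intro exI[of _ "b r * F r"]) simp
qed

text \<open>\<open>(b F)' = (b\<^sup>2 - A) F\<close>. Since \<open>e\<close> is never an interior
  point of \<open>{r1..r2}\<close>, the strict form of the inequality is available.\<close>

lemma bF_strict_increasing:
  assumes "r1 \<in> D" "r2 \<in> D" "r1 < r2"
  shows "b r1 * F r1 < b r2 * F r2"
proof (rule DERIV_pos_imp_increasing_open[OF \<open>r1 < r2\<close>])
  fix r assume r: "r1 < r" "r < r2"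
  then have rD: "r \<in> D" using between_in_D[OF assms(1,2)] by auto
  have "r < e" using r le_e[OF assms(2)] by simp
  have "((\<lambda>r. b r * F r) has_real_derivative ((b r)\<^sup>2 - A r) * F r) (at r)"
    by (auto intro!: derivative_eq_intros b_deriv F_deriv rD simp: power2_eq_square algebra_simps)
  moreover have "((b r)\<^sup>2 - A r) * F r > 0" using A_less[OF rD \<open>r < e\<close>] F_pos[OF rD] by simp
  ultimately show "\<exists>y. ((\<lambda>r. b r * F r) has_real_derivative y) (at r) \<and> 0 < y" by blast
next
  show "continuous_on {r1..r2} (\<lambda>r. b r * F r)"
    by (intro continuous_intros continuous_on_subset[OF b_cont] continuous_on_subset[OF F_cont])
      (use between_in_D[OF assms(1,2)] in auto)
qed

lemma curv_pos:
  assumes "0 \<le> t" "t \<le> pi/2" "r \<in> D" "0 \<le> x" "t < pi/2 \<or> 0 < x"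
  shows "0 < curv t r x"
proof (cases "t < pi/2")
  case True
  then have "0 < cos t" "0 \<le> sin t" using assms by (auto intro: cos_gt_zero_pi sin_ge_zero)
  then show ?thesis using assms b_pos[of r] by (auto simp: curv_def intro!: add_pos_nonneg)
next
  case False
  then have "t = pi/2" using assms by auto
  then show ?thesis using assms False by (simp only: curv_def cos_pi_half sin_pi_half) simp
qed

lemma angle_solutionD:
  assumes "angle_solution t0 t1 R r x"
  shows "continuous_on {t0..t1} r" "continuous_on {t0..t1} x" "r t0 = R" "x t0 = 0"
    "t \<in> {t0..t1} \<Longrightarrow> r t \<in> D" "t \<in> {t0<..t1} \<Longrightarrow> 0 < x t" "t \<in> {t0..t1} \<Longrightarrow> 0 \<le> x t"
    "t \<in> {t0<..<t1} \<Longrightarrow> (r has_real_derivative sin t / curv t (r t) (x t)) (at t)"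
    "t \<in> {t0<..<t1} \<Longrightarrow> (x has_real_derivative cos t / curv t (r t) (x t)) (at t)"
proof -
  show pos: "t \<in> {t0<..t1} \<Longrightarrow> 0 < x t" using assms unfolding angle_solution_def by blast
  show "t \<in> {t0..t1} \<Longrightarrow> 0 \<le> x t"
  proof (cases "t = t0")
    case True
    then show ?thesis using assms by (simp add: angle_solution_def)
  next
    case False
    assume "t \<in> {t0..t1}"
    then have "t \<in> {t0<..t1}" using False by auto
    then show ?thesis using assms unfolding angle_solution_def by (meson less_imp_le)
  qed
qed (use assms in \<open>unfold angle_solution_def, blast+\<close>)

lemma angle_solution_curv_pos:
  assumes "angle_solution t0 t1 R r x" "0 \<le> t0" "t0 < pi/2" "t1 \<le> pi/2" "t \<in> {t0..t1}"
  shows "0 < curv t (r t) (x t)"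
  using assms by (intro curv_pos) (auto intro: angle_solutionD[OF assms(1)])

lemma angle_solution_F_cont:
  assumes "angle_solution t0 t1 R r x"
  shows "continuous_on {t0..t1} (\<lambda>t. F (r t))" "continuous_on {t0..t1} (\<lambda>t. b (r t))"
  by (rule continuous_on_compose2[OF F_cont angle_solutionD(1)[OF assms]]
      continuous_on_compose2[OF b_cont angle_solutionD(1)[OF assms]],
      use angle_solutionD(5)[OF assms] in blast)+

lemma angle_solution_curv_cont:
  assumes "angle_solution t0 t1 R r x"
  shows "continuous_on {t0..t1} (\<lambda>t. curv t (r t) (x t))"
  unfolding curv_def
  by (intro continuous_intros angle_solutionD(2)[OF assms] angle_solution_F_cont(2)[OF assms]) simp

lemma angle_solution_strict_increasing:
  assumes sol: "angle_solution t0 t1 R r x" and t0: "0 \<le> t0" "t0 < pi/2" "t1 \<le> pi/2"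
    and "t0 \<le> t" "t < t'" "t' \<le> t1"
  shows "r t < r t'"
proof (rule DERIV_pos_imp_increasing_open[OF \<open>t < t'\<close>])
  show "continuous_on {t..t'} r"
    by (rule continuous_on_subset[OF angle_solutionD(1)[OF sol]]) (use assms in auto)
  fix u assume u: "t < u" "u < t'"
  then have "u \<in> {t0<..<t1}" using assms by auto
  moreover have "0 < sin u" by (rule sin_gt_zero) (use u assms pi_gt_zero in linarith)+
  moreover have "0 < curv u (r u) (x u)"
    by (rule angle_solution_curv_pos[OF sol]) (use u assms in auto)
  ultimately show "\<exists>y. (r has_real_derivative y) (at u) \<and> 0 < y"
    using angle_solutionD(8)[OF sol, of u] by (meson divide_pos_pos)
qed

text \<open>On the level curve \<open>d = c * F r / x\<close> is a decreasing function of \<open>r\<close>, and the reciprocal of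
  \<open>F / (x\<^sup>2 * (b * c + x * s / 2))\<close> is \<open>c ^ 3\<close> times \<open>b * F / d ^ 2 + s / 2 * F ^ 2 / d ^ 3\<close>.\<close>
lemma level_curve_monotone:
  assumes r: "r1 \<in> D" "r2 \<in> D" "r1 < r2" and x: "0 < x1" "0 < x2" and cs: "0 < c" "0 \<le> s"
    and G_deriv: "\<And>r. r \<in> {r1<..<r2} \<Longrightarrow> (G has_real_derivative F r) (at r)"
    and G_cont: "continuous_on {r1..r2} G"
    and level: "c * F r1 / x1 + s / 2 * G r1 = c * F r2 / x2 + s / 2 * G r2"
  shows "F r2 / (x2\<^sup>2 * (b r2 * c + x2 * s / 2)) \<le> F r1 / (x1\<^sup>2 * (b r1 * c + x1 * s / 2))"
proof -
  define d where "d r = c * F r2 / x2 + s / 2 * (G r2 - G r)" for r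
  have rD: "r \<in> D" if "r \<in> {r1..r2}" for r using between_in_D[OF r(1,2)] that by auto
  have G_mono: "G r \<le> G r2" if "r \<in> {r1..r2}" for r
  proof (rule DERIV_nonneg_imp_increasing_open[of r r2 G])
    show "continuous_on {r..r2} G" by (rule continuous_on_subset[OF G_cont]) (use that in auto)
    show "r \<le> r2" using that by simp
    fix u assume "r < u" "u < r2"
    then show "\<exists>y. (G has_real_derivative y) (at u) \<and> 0 \<le> y"
      using that by (intro exI[of _ "F u"] conjI G_deriv less_imp_le[OF F_pos] rD) auto
  qed
  have d_pos: "d r > 0" if "r \<in> {r1..r2}" for r
    unfolding d_def using G_mono[OF that] x cs F_pos[OF r(2)]
    by (intro add_pos_nonneg) (auto intro!: divide_pos_pos mult_nonneg_nonneg)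
  define i where "i r = inverse (d r)" for r
  have i_pos: "i r > 0" if "r \<in> {r1..r2}" for r using d_pos[OF that] by (simp add: i_def)
  define W where "W r = b r * F r * (i r)^2 + s / 2 * (F r)^2 * (i r)^3" for r
  have "W r1 \<le> W r2"
  proof (rule DERIV_nonneg_imp_increasing_open[of r1 r2 W])
    have "continuous_on {r1..r2} d" unfolding d_def by (intro continuous_intros G_cont)
    then have "continuous_on {r1..r2} i" unfolding i_def using d_pos
      by (intro continuous_intros) force+
    moreover have "continuous_on {r1..r2} b" "continuous_on {r1..r2} F"
      using rD by (auto intro: continuous_on_subset[OF b_cont] continuous_on_subset[OF F_cont])
    ultimately show "continuous_on {r1..r2} W"
      unfolding W_def by (intro continuous_intros)
    fix r assume "r1 < r" "r < r2"
    then have rr: "r \<in> {r1<..<r2}" and rI: "r \<in> {r1..r2}" by auto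
    note pos = i_pos[OF rI] F_pos[OF rD[OF rI]] b_pos[OF rD[OF rI]]
    have dd: "(d has_real_derivative - (s / 2 * F r)) (at r)"
      unfolding d_def by (auto intro!: derivative_eq_intros G_deriv rr)
    have id: "(i has_real_derivative s / 2 * F r * (i r)^2) (at r)"
      unfolding i_def using d_pos[OF rI]
      by (intro DERIV_cong[OF DERIV_inverse'[OF dd]]) (simp_all add: power2_eq_square)
    \<comment> \<open>Only the first summand has a sign in doubt, and there
      \<open>A \<le> b\<^sup>2\<close> decides; the other two come from the variation of
      \<open>i\<close> and are nonnegative.\<close>
    define W' where "W' = F r * ((b r)^2 - A r) * (i r)^2 + 2 * s * b r * (F r)^2 * (i r)^3
        + 3 / 4 * s^2 * (F r)^3 * (i r)^4"
    have "(W has_real_derivative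
        (- A r * F r + b r * F r * b r) * (i r)^2 + 2 * (i r) * (s / 2 * F r * (i r)^2) * (b r * F r)
        + (s / 2 * (2 * F r * (b r * F r)) * (i r)^3 + 3 * (i r)^2 * (s / 2 * F r * (i r)^2) * (s / 2 * (F r)^2))) (at r)"
      unfolding W_def
      by (rule derivative_eq_intros b_deriv[OF rD[OF rI]] F_deriv[OF rD[OF rI]] id refl)+ simp
    then have "(W has_real_derivative W') (at r)"
      by (rule DERIV_cong) (simp add: W'_def algebra_simps power2_eq_square power3_eq_cube power4_eq_xxxx)
    moreover have "W' \<ge> 0"
      unfolding W'_def using pos cs A_le[OF rD[OF rI]]
      by (intro add_nonneg_nonneg mult_nonneg_nonneg) auto
    ultimately show "\<exists>y. (W has_real_derivative y) (at r) \<and> 0 \<le> y" by blast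
  qed (use r in auto)
  moreover have "W r2 = (x2\<^sup>2 * (b r2 * c + x2 * s / 2)) / (c^3 * F r2)"
  proof -
    have "i r2 = x2 / (c * F r2)" by (simp add: d_def i_def)
    with x cs F_pos[OF r(2)] show ?thesis unfolding W_def
      by (simp del: times_divide_eq_right add: power_divide) (simp add: field_simps power2_eq_square power3_eq_cube)
  qed
  moreover have "W r1 = (x1\<^sup>2 * (b r1 * c + x1 * s / 2)) / (c^3 * F r1)"
  proof -
    have "d r1 = c * F r1 / x1" using level unfolding d_def right_diff_distrib by linarith
    then have "i r1 = x1 / (c * F r1)" by (simp add: i_def)
    with x cs F_pos[OF r(1)] show ?thesis unfolding W_def
      by (simp del: times_divide_eq_right add: power_divide) (simp add: field_simps power2_eq_square power3_eq_cube)
  qed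
  ultimately have le: "(x1\<^sup>2 * (b r1 * c + x1 * s / 2)) / (c^3 * F r1)
      \<le> (x2\<^sup>2 * (b r2 * c + x2 * s / 2)) / (c^3 * F r2)" by simp
  have p: "b r1 * c + x1 * s / 2 > 0" "b r2 * c + x2 * s / 2 > 0"
    using x cs b_pos r by (auto intro!: add_pos_nonneg)
  have "inverse ((x2\<^sup>2 * (b r2 * c + x2 * s / 2)) / (c^3 * F r2))
      \<le> inverse ((x1\<^sup>2 * (b r1 * c + x1 * s / 2)) / (c^3 * F r1))"
    by (rule le_imp_inverse_le[OF le]) (use p x cs F_pos r in auto)
  then have "c^3 * (F r2 / (x2\<^sup>2 * (b r2 * c + x2 * s / 2)))
      \<le> c^3 * (F r1 / (x1\<^sup>2 * (b r1 * c + x1 * s / 2)))"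
    by (simp add: inverse_eq_divide)
  then show ?thesis using cs by (simp only: mult_le_cancel_left_pos zero_less_power)
qed

end

section \<open>Comparison of two solutions\<close>

context shrinker_region begin

context
  fixes t0 R1 R2 :: real and r1 x1 r2 x2 :: "real \<Rightarrow> real"
  assumes t0: "0 \<le> t0" "t0 < pi/2"
    and sol1: "angle_solution t0 (pi/2) R1 r1 x1"
    and sol2: "angle_solution t0 (pi/2) R2 r2 x2"
begin

abbreviation "k1 t \<equiv> curv t (r1 t) (x1 t)"
abbreviation "k2 t \<equiv> curv t (r2 t) (x2 t)"

text \<open>The difference \<open>\<delta> = x2 - x1\<close> solves the linear equation
  \<open>\<delta>' + N \<delta> = (cos t)\<^sup>2 (b(r1) - b(r2)) / (k1 k2)\<close>. As
  \<open>b\<close> decreases, the right side is positive as long as \<open>r1 < r2\<close>;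
  \<open>exp (J t)\<close> is the integrating factor.\<close>

lemma heights_ordered:
  assumes t: "t1 \<in> {t0<..pi/2}" and lt: "\<And>t. t \<in> {t0<..<t1} \<Longrightarrow> r1 t < r2 t"
  shows "x1 t1 < x2 t1"
proof -
  note s1 = angle_solutionD[OF sol1] and s2 = angle_solutionD[OF sol2]
  have k_pos: "k1 t > 0" "k2 t > 0" if "t \<in> {t0..pi/2}" for t
    using angle_solution_curv_pos[OF sol1 t0 order_refl that]
      angle_solution_curv_pos[OF sol2 t0 order_refl that] by auto
  define N where "N t = cos t * sin t / (2 * k1 t * k2 t)" for t
  have N_cont: "continuous_on {t0..pi/2} N"
    unfolding N_def using k_pos
    by (intro continuous_intros angle_solution_curv_cont[OF sol1] angle_solution_curv_cont[OF sol2]) force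
  define J where "J t = integral {t0..t} N" for t
  have J: "(J has_real_derivative N t) (at t)" if "t \<in> {t0<..<pi/2}" for t
    unfolding J_def by (rule integral_has_real_derivative_at[OF N_cont that])
  have J_cont: "continuous_on {t0..pi/2} J"
    unfolding J_def by (intro indefinite_integral_continuous_1 integrable_continuous_real N_cont)
  define f where "f t = exp (J t) * (x2 t - x1 t)" for t
  have "f t0 < f t1"
  proof (rule DERIV_pos_imp_increasing_open[of t0 t1 f])
    show "t0 < t1" using t by simp
    have "continuous_on {t0..pi/2} f" unfolding f_def by (intro continuous_intros J_cont s1 s2)
    then show "continuous_on {t0..t1} f" by (rule continuous_on_subset) (use t in auto)
    fix u assume u: "t0 < u" "u < t1"
    then have uI: "u \<in> {t0<..<pi/2}" and uI': "u \<in> {t0..pi/2}" using t by auto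
    have "cos u > 0" using uI t0 by (intro cos_gt_zero_pi) auto
    have bb: "b (r1 u) > b (r2 u)"
      by (rule b_strict_decreasing) (use lt[of u] u s1(5)[OF uI'] s2(5)[OF uI'] in auto)
    note kp = k_pos[OF uI']
    have "(f has_real_derivative exp (J u) * (N u * (x2 u - x1 u) + (cos u / k2 u - cos u / k1 u))) (at u)"
      unfolding f_def
      by (rule DERIV_cong[OF DERIV_mult[OF DERIV_fun_exp[OF J[OF uI]] DERIV_diff[OF s2(9)[OF uI] s1(9)[OF uI]]]])
        (simp add: algebra_simps)
    moreover have "cos u / k2 u - cos u / k1 u = cos u * (k1 u - k2 u) / (k1 u * k2 u)"
      using kp by (simp add: field_simps)
    moreover have "k1 u - k2 u = (b (r1 u) - b (r2 u)) * cos u - (x2 u - x1 u) * sin u / 2"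
      by (simp add: curv_def algebra_simps diff_divide_distrib)
    moreover have "N u * (x2 u - x1 u) + cos u * ((b (r1 u) - b (r2 u)) * cos u - (x2 u - x1 u) * sin u / 2) / (k1 u * k2 u)
        = (cos u)\<^sup>2 * (b (r1 u) - b (r2 u)) / (k1 u * k2 u)"
      using kp by (simp add: N_def field_simps power2_eq_square)
    moreover have "exp (J u) * ((cos u)\<^sup>2 * (b (r1 u) - b (r2 u)) / (k1 u * k2 u)) > 0"
      using \<open>cos u > 0\<close> bb kp by simp
    ultimately show "\<exists>y. (f has_real_derivative y) (at u) \<and> 0 < y" by metis
  qed
  then have "0 < exp (J t1) * (x2 t1 - x1 t1)" using s1(4) s2(4) by (simp add: f_def)
  then show ?thesis by (simp add: zero_less_mult_iff)
qed

text \<open>At a first meeting of the radii the second curve is already higher, so the sign of the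
  difference \<open>k\<close> of the two values of \<open>K\<close> is known there. The proof shows
  that this sign cannot be attained.\<close>

lemma radii_ordered:
  assumes R: "R1 < R2" and t: "t \<in> {t0..pi/2}"
  shows "r1 t < r2 t"
proof (rule ccontr)
  assume "\<not> r1 t < r2 t"
  note s1 = angle_solutionD[OF sol1] and s2 = angle_solutionD[OF sol2]
  have k_pos: "k1 t > 0" "k2 t > 0" if "t \<in> {t0..pi/2}" for t
    using angle_solution_curv_pos[OF sol1 t0 order_refl that]
      angle_solution_curv_pos[OF sol2 t0 order_refl that] by auto
  have xi_cont: "continuous_on {t0..pi/2} (\<lambda>t. r2 t - r1 t)" by (intro continuous_intros s1 s2)
  obtain T where T: "T \<in> {t0<..t}" "r2 T - r1 T = 0" "\<And>u. u \<in> {t0..<T} \<Longrightarrow> 0 < r2 u - r1 u"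
    using first_nonpos_point[OF xi_cont _ t] R \<open>\<not> r1 t < r2 t\<close> s1(3) s2(3) by auto
  have T_le: "T \<in> {t0<..pi/2}" "T \<in> {t0..pi/2}" using T(1) t by auto
  have r_less: "r1 u < r2 u" if "u \<in> {t0..<T}" for u using T(3)[OF that] by simp
  have x_less: "x1 u < x2 u" if "u \<in> {t0<..T}" for u
    by (rule heights_ordered) (use that T_le r_less in auto)
  have RD: "R1 \<in> D" "R2 \<in> D" using s1(3) s1(5)[of t0] s2(3) s2(5)[of t0] t0 by auto
  \<comment> \<open>The base point is irrelevant for \<open>k\<close>: another antiderivative
    changes both values of \<open>K\<close> by the same multiple of \<open>sin t\<close>.
    \<open>R1\<close> is the smallest radius that occurs on either curve.\<close>
  define G where "G r = integral {R1..r} F" for r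
  have F_contI: "continuous_on {R1..e} F"
    by (rule continuous_on_subset[OF F_cont]) (use between_in_D[OF RD(1) e_in] in auto)
  have G: "(G has_real_derivative F r) (at r)" if "r \<in> {R1<..<e}" for r
    unfolding G_def by (rule integral_has_real_derivative_at[OF F_contI that])
  have G_cont: "continuous_on {R1..e} G"
    unfolding G_def by (intro indefinite_integral_continuous_1 integrable_continuous_real F_contI)
  have G_mono: "G r < G r'" if "R1 \<le> r" "r < r'" "r' \<le> e" for r r'
  proof (rule DERIV_pos_imp_increasing_open[of r r' G])
    show "continuous_on {r..r'} G" by (rule continuous_on_subset[OF G_cont]) (use that in auto)
    fix u assume "r < u" "u < r'"
    then show "\<exists>y. (G has_real_derivative y) (at u) \<and> 0 < y"
      using that by (intro exI[of _ "F u"] conjI G F_pos between_in_D[OF RD(1) e_in]) auto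
  qed (use that in auto)
  have r_range: "r1 u \<in> {R1..e}" "r2 u \<in> {R1..e}" if "u \<in> {t0..pi/2}" for u
    using that angle_solution_strict_increasing[OF sol1 t0 order_refl, of t0 u]
      angle_solution_strict_increasing[OF sol2 t0 order_refl, of t0 u]
      le_e[OF s1(5)] le_e[OF s2(5)] s1(3) s2(3) R by (cases "u = t0"; force)+
  have r_range': "r1 u \<in> {R1<..<e}" "r2 u \<in> {R1<..<e}" if "u \<in> {t0<..<pi/2}" for u
  proof -
    have "r1 t0 < r1 u" "r1 u < r1 (pi/2)" "r2 t0 < r2 u" "r2 u < r2 (pi/2)"
      using that by (auto intro!: angle_solution_strict_increasing[OF sol1 t0 order_refl]
          angle_solution_strict_increasing[OF sol2 t0 order_refl])
    then show "r1 u \<in> {R1<..<e}" "r2 u \<in> {R1<..<e}"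
      using s1(3) s2(3) R le_e[OF s1(5)[of "pi/2"]] le_e[OF s2(5)[of "pi/2"]] t0 by auto
  qed
  \<comment> \<open>The derivative of \<open>cos t * F / x\<close> is \<open>- (sin t)\<^sup>2 F /
    (2 \<kappa>) - (cos t)\<^sup>2 F / (x\<^sup>2 \<kappa>)\<close>. The summand with
    \<open>G\<close> cancels the first term and leaves \<open>cos t\<close> times a difference of
    \<open>G / 2\<close> and \<open>cos t * Q\<close>, where \<open>Q\<close> can be compared on
    level curves of \<open>K\<close>.\<close>
  define K where "K r x t = cos t * F (r t) / x t + sin t / 2 * G (r t)" for r x :: "real \<Rightarrow> real" and t
  have K_deriv: "(K r x has_real_derivative
      cos t * (G (r t) / 2 - cos t * F (r t) / ((x t)\<^sup>2 * curv t (r t) (x t)))) (at t)"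
    if sol: "angle_solution t0 (pi/2) R r x" and tI: "t \<in> {t0<..<pi/2}" and rr: "r t \<in> {R1<..<e}"
    for R r x t
  proof -
    note s = angle_solutionD[OF sol]
    have xp: "x t > 0" using s(6)[of t] tI by simp
    have kp: "curv t (r t) (x t) > 0"
      by (rule angle_solution_curv_pos[OF sol t0 order_refl]) (use tI in auto)
    have rD: "r t \<in> D" using s(5)[of t] tI by auto
    define \<kappa> where "\<kappa> = curv t (r t) (x t)"
    have dF: "((\<lambda>t. F (r t)) has_real_derivative b (r t) * F (r t) * (sin t / \<kappa>)) (at t)"
      unfolding \<kappa>_def by (rule DERIV_chain2[OF F_deriv[OF rD] s(8)[OF tI]])
    have dG: "((\<lambda>t. G (r t)) has_real_derivative F (r t) * (sin t / \<kappa>)) (at t)"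
      unfolding \<kappa>_def by (rule DERIV_chain2[OF G[OF rr] s(8)[OF tI]])
    have dx: "(x has_real_derivative cos t / \<kappa>) (at t)" unfolding \<kappa>_def by (rule s(9)[OF tI])
    have "(K r x has_real_derivative
       (((- sin t * 1) * F (r t) + b (r t) * F (r t) * (sin t / \<kappa>) * cos t) * x t - cos t * F (r t) * (cos t / \<kappa>)) / (x t * x t)
       + (cos t * 1 / 2 * G (r t) + F (r t) * (sin t / \<kappa>) * (sin t / 2))) (at t)"
      unfolding K_def using xp
      by (intro DERIV_add DERIV_mult DERIV_divide dF dG dx DERIV_cdivide DERIV_cos DERIV_sin)
         (auto intro!: derivative_eq_intros)
    moreover have "b (r t) * cos t = \<kappa> - x t * sin t / 2" by (simp add: \<kappa>_def curv_def)
    then have eq: "b (r t) * F (r t) * (sin t / \<kappa>) * cos t = F (r t) * sin t - F (r t) * x t * (sin t)\<^sup>2 / (2 * \<kappa>)"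
    proof -
      have "b (r t) * F (r t) * (sin t / \<kappa>) * cos t = (b (r t) * cos t) * (F (r t) * sin t / \<kappa>)" by simp
      also have "\<dots> = (\<kappa> - x t * sin t / 2) * (F (r t) * sin t / \<kappa>)"
        using \<open>b (r t) * cos t = _\<close> by simp
      finally show ?thesis using kp unfolding \<kappa>_def[symmetric] by (simp add: field_simps power2_eq_square)
    qed
    ultimately show ?thesis
      using xp kp unfolding \<kappa>_def[symmetric] eq
      by (elim DERIV_cong) (simp add: field_simps power2_eq_square)
  qed
  define k where "k t = K r2 x2 t - K r1 x1 t" for t
  define Q where "Q r x t = F (r t) / ((x t)\<^sup>2 * curv t (r t) (x t))" for r x :: "real \<Rightarrow> real" and t
  define k' where "k' t = cos t * ((G (r2 t) - G (r1 t)) / 2 - cos t * (Q r2 x2 t - Q r1 x1 t))" for t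
  have k_deriv: "(k has_real_derivative k' t) (at t)" if tI: "t \<in> {t0<..<pi/2}" for t
    unfolding k_def
    by (rule DERIV_cong[OF DERIV_diff[OF K_deriv[OF sol2 tI r_range'(2)[OF tI]] K_deriv[OF sol1 tI r_range'(1)[OF tI]]]])
      (simp add: k'_def Q_def algebra_simps diff_divide_distrib)
  \<comment> \<open>The interval is open at \<open>t0\<close> since \<open>x t0 = 0\<close> makes
    \<open>K\<close> singular there.\<close>
  have K_cont: "continuous_on {t0<..pi/2} (K r x)"
    if sol: "angle_solution t0 (pi/2) R r x" and rr: "\<And>u. u \<in> {t0..pi/2} \<Longrightarrow> r u \<in> {R1..e}" for R r x
  proof -
    have sub: "{t0<..pi/2} \<subseteq> {t0..pi/2}" by auto
    note s = angle_solutionD[OF sol]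
    have "continuous_on {t0..pi/2} (\<lambda>t. G (r t))"
      by (rule continuous_on_compose2[OF G_cont s(1)]) (use rr in auto)
    then show ?thesis unfolding K_def using s(6)
      by (intro continuous_intros continuous_on_subset[OF angle_solution_F_cont(1)[OF sol] sub]
          continuous_on_subset[OF s(2) sub]) (force intro: continuous_on_subset[OF _ sub])+
  qed
  have k_cont: "continuous_on {t0<..pi/2} k"
    unfolding k_def by (intro continuous_intros K_cont[OF sol1] K_cont[OF sol2] r_range)
  \<comment> \<open>Because of this singularity the reciprocals \<open>Y = x / F\<close> are
    compared. Both vanish at \<open>t0\<close>, with slope \<open>1 / (b R * F R)\<close> there,
    whatever the initial slope of the curve. As \<open>b F\<close> increases, the second slope is
    smaller, hence \<open>F / x\<close> is larger for the second curve. The \<open>G\<close> term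
    only helps.\<close>
  have start: "\<exists>d>0. \<forall>u\<in>{t0<..<T}. u < t0 + d \<longrightarrow> 0 < k u"
  proof -
    define Y where "Y r x t = x t / F (r t)" for r x :: "real \<Rightarrow> real" and t
    define Y' where "Y' r x t = (cos t - b (r t) * x t * sin t) / (curv t (r t) (x t) * F (r t))"
      for r x :: "real \<Rightarrow> real" and t
    have Y_cont: "continuous_on {t0..pi/2} (Y r x)" "continuous_on {t0..pi/2} (Y' r x)"
      and Y_deriv: "t \<in> {t0<..<pi/2} \<Longrightarrow> (Y r x has_real_derivative Y' r x t) (at t)"
      and Y0: "Y r x t0 = 0" "Y' r x t0 = 1 / (b R * F R)"
      if sol: "angle_solution t0 (pi/2) R r x" for R r x t
    proof -
      note s = angle_solutionD[OF sol]
      have kp: "curv u (r u) (x u) > 0" if "u \<in> {t0..pi/2}" for u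
        by (rule angle_solution_curv_pos[OF sol t0 order_refl that])
      have Fp: "F (r u) > 0" if "u \<in> {t0..pi/2}" for u using F_pos s(5)[OF that] by simp
      show "continuous_on {t0..pi/2} (Y r x)" unfolding Y_def using Fp
        by (intro continuous_intros s angle_solution_F_cont[OF sol]) force
      show "continuous_on {t0..pi/2} (Y' r x)" unfolding Y'_def using Fp kp
        by (intro continuous_intros s angle_solution_F_cont[OF sol] angle_solution_curv_cont[OF sol]) force
      show "Y r x t0 = 0" by (simp add: Y_def s)
      have "cos t0 > 0" using t0 by (intro cos_gt_zero_pi) auto
      then show "Y' r x t0 = 1 / (b R * F R)" by (simp add: Y'_def s curv_def)
      show "(Y r x has_real_derivative Y' r x t) (at t)" if tI: "t \<in> {t0<..<pi/2}"
      proof -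
        have tI': "t \<in> {t0..pi/2}" using tI by auto
        define \<kappa> where "\<kappa> = curv t (r t) (x t)"
        have dF: "((\<lambda>t. F (r t)) has_real_derivative b (r t) * F (r t) * (sin t / \<kappa>)) (at t)"
          unfolding \<kappa>_def by (rule DERIV_chain2[OF F_deriv[OF s(5)[OF tI']] s(8)[OF tI]])
        show ?thesis unfolding Y_def
          by (rule DERIV_cong[OF DERIV_divide[OF s(9)[OF tI] dF]])
            (use kp[OF tI'] Fp[OF tI'] in \<open>auto simp: Y'_def \<kappa>_def[symmetric] field_simps\<close>)
      qed
    qed
    define y where "y t = Y' r1 x1 t - Y' r2 x2 t" for t
    have "continuous_on {t0..pi/2} y" unfolding y_def by (intro continuous_intros Y_cont(2)[OF sol1] Y_cont(2)[OF sol2])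
    moreover have "0 < y t0"
      unfolding y_def Y0(2)[OF sol1] Y0(2)[OF sol2]
      using bF_strict_increasing[OF RD R] b_pos F_pos RD by (simp add: frac_less2)
    ultimately obtain d where d: "d > 0" "\<And>u. u \<in> {t0..pi/2} \<Longrightarrow> \<bar>u - t0\<bar> < d \<Longrightarrow> 0 < y u"
      using continuous_on_pos_nearby[of "{t0..pi/2}" y t0] t0 by auto
    show ?thesis
    proof (intro exI[of _ d] conjI ballI impI)
      fix u assume u: "u \<in> {t0<..<T}" "u < t0 + d"
      have uI: "u \<in> {t0<..pi/2}" "u \<in> {t0..pi/2}" using u T_le by auto
      have "(\<lambda>t. Y r1 x1 t - Y r2 x2 t) t0 < (\<lambda>t. Y r1 x1 t - Y r2 x2 t) u"
      proof (rule DERIV_pos_imp_increasing_open[of t0 u "\<lambda>t. Y r1 x1 t - Y r2 x2 t"])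
        have "continuous_on {t0..pi/2} (\<lambda>t. Y r1 x1 t - Y r2 x2 t)"
          by (intro continuous_intros Y_cont(1)[OF sol1] Y_cont(1)[OF sol2])
        then show "continuous_on {t0..u} (\<lambda>t. Y r1 x1 t - Y r2 x2 t)"
          by (rule continuous_on_subset) (use uI in auto)
        fix v assume v: "t0 < v" "v < u"
        then have "v \<in> {t0<..<pi/2}" using uI by auto
        then have "((\<lambda>t. Y r1 x1 t - Y r2 x2 t) has_real_derivative y v) (at v)"
          unfolding y_def by (intro DERIV_diff Y_deriv[OF sol1] Y_deriv[OF sol2])
        moreover have "0 < y v" by (rule d(2)) (use v u uI in auto)
        ultimately show "\<exists>y. ((\<lambda>t. Y r1 x1 t - Y r2 x2 t) has_real_derivative y) (at v) \<and> 0 < y"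
          by blast
      qed (use u in auto)
      then have less: "x2 u / F (r2 u) < x1 u / F (r1 u)"
        unfolding Y0(1)[OF sol1] Y0(1)[OF sol2] by (simp add: Y_def)
      have pos: "x1 u > 0" "x2 u > 0" "F (r1 u) > 0" "F (r2 u) > 0"
        using s1(6) s2(6) F_pos s1(5) s2(5) uI by auto
      then have "F (r1 u) / x1 u < F (r2 u) / x2 u" using less by (simp add: field_simps)
      moreover have "cos u > 0" "sin u > 0" using u T_le t0 by (auto intro!: cos_gt_zero_pi sin_gt_zero)
      moreover have "G (r1 u) < G (r2 u)"
        using G_mono r_less[of u] r_range[OF uI(2)] u by auto
      ultimately have "cos u * (F (r2 u) / x2 u - F (r1 u) / x1 u) + sin u / 2 * (G (r2 u) - G (r1 u)) > 0"
        by (intro add_pos_pos mult_pos_pos) auto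
      then show "0 < k u" by (simp add: k_def K_def algebra_simps)
    qed (use d in auto)
  qed
  have k_pos: "0 < k v" if v: "v \<in> {t0<..<T}" for v
  proof -
    obtain d where d: "d > 0" "\<And>u. u \<in> {t0<..<T} \<Longrightarrow> u < t0 + d \<Longrightarrow> 0 < k u" using start by blast
    define u where "u = min v (t0 + d / 2)"
    have u: "t0 < u" "u \<le> v" "u < T" "u < t0 + d" using d(1) v by (auto simp: u_def)
    show ?thesis
    proof (rule positive_if_deriv_pos_at_zeros[of u v k])
      show "continuous_on {u..v} k" by (rule continuous_on_subset[OF k_cont]) (use u v T_le in auto)
      show "0 < k u" by (rule d) (use u in auto)
      \<comment> \<open>At a zero of \<open>k\<close> the two points lie on one level curve of
        \<open>K\<close> for the angle \<open>w\<close>, so \<open>Q\<close> is not larger at the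
        right one. The strictly increasing \<open>G\<close> then makes \<open>k'\<close>
        positive.\<close>
      fix w assume w: "w \<in> {u<..v}" "k w = 0"
      have wI: "w \<in> {t0<..<pi/2}" "w \<in> {t0<..pi/2}" "w \<in> {t0..pi/2}" using w u v T_le by auto
      have rl: "r1 w < r2 w" using r_less[of w] w u v by auto
      have cs: "cos w > 0" "sin w > 0" using wI t0 by (auto intro!: cos_gt_zero_pi sin_gt_zero)
      have "F (r2 w) / ((x2 w)\<^sup>2 * (b (r2 w) * cos w + x2 w * sin w / 2))
          \<le> F (r1 w) / ((x1 w)\<^sup>2 * (b (r1 w) * cos w + x1 w * sin w / 2))"
      proof (rule level_curve_monotone[of _ _ _ _ _ _ G])
        show "cos w * F (r1 w) / x1 w + sin w / 2 * G (r1 w) = cos w * F (r2 w) / x2 w + sin w / 2 * G (r2 w)"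
          using w(2) by (simp add: k_def K_def)
        show "continuous_on {r1 w..r2 w} G"
          by (rule continuous_on_subset[OF G_cont]) (use r_range[OF wI(3)] in auto)
        show "(G has_real_derivative F r) (at r)" if "r \<in> {r1 w<..<r2 w}" for r
          by (rule G) (use that r_range[OF wI(3)] in auto)
      qed (use s1 s2 wI rl cs in auto)
      then have "Q r2 x2 w \<le> Q r1 x1 w" by (simp add: Q_def curv_def)
      moreover have "G (r1 w) < G (r2 w)" using G_mono rl r_range[OF wI(3)] by auto
      ultimately have "cos w * (Q r2 x2 w - Q r1 x1 w) \<le> 0" "0 < (G (r2 w) - G (r1 w)) / 2"
        using cs by (auto intro: mult_nonneg_nonpos)
      then have "k' w > 0" unfolding k'_def using cs by (intro mult_pos_pos) auto
      then show "\<exists>y>0. (k has_real_derivative y) (at w within {u..v})"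
        using k_deriv[OF wI(1)] has_field_derivative_at_within by blast
    qed (use u in auto)
  qed
  have xT: "x1 T < x2 T" "0 < x1 T" using x_less[of T] T_le s1(6)[of T] by auto
  have FT: "F (r1 T) > 0" using F_pos s1(5) T_le by auto
  have rT: "r2 T = r1 T" using T(2) by simp
  have cT: "cos T \<ge> 0" "sin T > 0" using T_le t0 by (auto intro!: cos_ge_zero sin_gt_zero)
  have "Q r2 x2 T < Q r1 x1 T"
  proof -
    have "curv T (r1 T) (x1 T) \<le> curv T (r2 T) (x2 T)"
      using xT cT by (simp add: curv_def rT)
    moreover have "(x1 T)\<^sup>2 < (x2 T)\<^sup>2" using xT by (intro power_strict_mono) auto
    moreover have k1T: "0 < k1 T" by (rule angle_solution_curv_pos[OF sol1 t0 order_refl T_le(2)])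
    ultimately have less: "(x1 T)\<^sup>2 * k1 T < (x2 T)\<^sup>2 * k2 T"
      using xT by (intro mult_less_le_imp_less) auto
    have "0 < (x1 T)\<^sup>2 * k1 T" using xT k1T by simp
    then show ?thesis unfolding Q_def rT
      using FT less by (intro divide_strict_left_mono) (auto simp: rT)
  qed
  moreover have "continuous_on {t0<..pi/2} (\<lambda>t. Q r1 x1 t - Q r2 x2 t)"
  proof -
    have sub: "{t0<..pi/2} \<subseteq> {t0..pi/2}" by auto
    have "continuous_on {t0<..pi/2} (Q r x)" if sol: "angle_solution t0 (pi/2) R r x" for R r x
      unfolding Q_def using less_imp_neq[OF angle_solution_curv_pos[OF sol t0 order_refl]]
        less_imp_neq[OF angle_solutionD(6)[OF sol]]
      by (intro continuous_intros continuous_on_subset[OF angle_solution_F_cont(1)[OF sol] sub]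
          continuous_on_subset[OF angle_solutionD(2)[OF sol] sub]
          continuous_on_subset[OF angle_solution_curv_cont[OF sol] sub])
        (metis mult_eq_0_iff power_eq_0_iff subset_iff sub)
    then show ?thesis using sol1 sol2 by (intro continuous_intros) auto
  qed
  ultimately obtain d where d: "d > 0"
    "\<And>u. u \<in> {t0<..pi/2} \<Longrightarrow> \<bar>u - T\<bar> < d \<Longrightarrow> 0 < Q r1 x1 u - Q r2 x2 u"
    using continuous_on_pos_nearby[of "{t0<..pi/2}" "\<lambda>t. Q r1 x1 t - Q r2 x2 t" T] T_le by auto
  define u where "u = max (T - d / 2) ((t0 + T) / 2)"
  have u: "t0 < u" "u < T" "T - u < d" using d(1) T_le unfolding u_def by (auto simp: max_def field_simps)
  \<comment> \<open>Positivity of \<open>k\<close> before \<open>T\<close> is not yet a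
    contradiction: if \<open>T = pi/2\<close>, then \<open>cos T = 0\<close> and
    \<open>k T = 0\<close>. The strict inequality for \<open>Q\<close> at \<open>T\<close>, due to
    equal radii and different heights, persists nearby and makes \<open>k\<close> increase up to
    \<open>T\<close>, hence positive at \<open>T\<close>.\<close>
  have "k u < k T"
  proof (rule DERIV_pos_imp_increasing_open[of u T k])
    show "continuous_on {u..T} k" by (rule continuous_on_subset[OF k_cont]) (use u T_le in auto)
    fix w assume w: "u < w" "w < T"
    have wI: "w \<in> {t0<..<pi/2}" "w \<in> {t0<..pi/2}" "w \<in> {t0..pi/2}" using w u T_le by auto
    have cs: "cos w > 0" using wI t0 by (auto intro!: cos_gt_zero_pi)
    have "0 < Q r1 x1 w - Q r2 x2 w" by (rule d) (use w u wI in auto)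
    moreover have "G (r1 w) < G (r2 w)" using G_mono r_less[of w] w u r_range[OF wI(3)] by auto
    ultimately have "cos w * (Q r2 x2 w - Q r1 x1 w) < 0" "0 < (G (r2 w) - G (r1 w)) / 2"
      using cs by (auto intro: mult_pos_neg)
    then have "k' w > 0" unfolding k'_def using cs by (intro mult_pos_pos) auto
    then show "\<exists>y. (k has_real_derivative y) (at w) \<and> 0 < y" using k_deriv[OF wI(1)] by blast
  qed (use u in auto)
  moreover have "0 < k u" by (rule k_pos) (use u in auto)
  moreover have "k T \<le> 0"
  proof -
    have "F (r1 T) / x2 T \<le> F (r1 T) / x1 T" using xT FT by (intro divide_left_mono) auto
    then show ?thesis using cT by (simp add: k_def K_def rT mult_left_mono flip: times_divide_eq_right)
  qed
  ultimately show False by simp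
qed

end

end

section \<open>From graphs to the angle parametrisation and back\<close>

text \<open>The infinite slope is a separate case because \<open>real_of_ereal \<infinity>\<close>
  is \<open>0\<close>, which would give the angle \<open>pi/2\<close> instead of
  \<open>0\<close>.\<close>

definition start_angle :: "ereal \<Rightarrow> real" where
  "start_angle C = (if C = \<infinity> then 0 else pi/2 - arctan (real_of_ereal C))"

lemma start_angle_bounds:
  assumes "0 < C"
  shows "0 \<le> start_angle C" "start_angle C < pi/2"
proof -
  have "0 < real_of_ereal C" if "C \<noteq> \<infinity>" using assms that by (cases C) auto
  then show "0 \<le> start_angle C" "start_angle C < pi/2"
    using arctan_ubound[of "real_of_ereal C"] by (auto simp: start_angle_def)
qed

lemma shrinker_solution_on_subset:
  assumes "shrinker_solution_on n S g p" "T \<subseteq> S"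
  shows "shrinker_solution_on n T g p"
  using assms unfolding shrinker_solution_on_def
  by (meson DERIV_subset subset_iff)

lemma shrinker_ivp_restrict:
  assumes "shrinker_ivp n C R \<rho> g p" "R < \<rho>'" "\<rho>' \<le> \<rho>"
  shows "shrinker_ivp n C R \<rho>' g p"
proof -
  have "{R<..\<rho>'} \<subseteq> {R<..\<rho>}" "{R..\<rho>'} \<subseteq> {R..\<rho>}" using assms by auto
  then show ?thesis using assms(1) unfolding shrinker_ivp_def
    by (auto split: if_splits intro: shrinker_solution_on_subset continuous_on_subset)
qed

text \<open>This puts finite and infinite initial slope on the same footing: the equation is kept
  only to the right of \<open>R\<close>, and at \<open>R\<close> itself just the continuity of
  \<open>g\<close> and of the angle. The angle stays continuous there even when the slope tends to
  infinity.\<close>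

lemma shrinker_ivp_cases:
  assumes ivp: "shrinker_ivp n C R \<rho> g p" and C: "0 < C" and "R < \<rho>"
  shows "shrinker_solution_on n {R<..\<rho>} g p" "continuous_on {R..\<rho>} g" "g R = 0"
    "continuous_on {R..\<rho>} (\<lambda>r. if r = R then start_angle C else pi/2 - arctan (p r))"
proof -
  show sol: "shrinker_solution_on n {R<..\<rho>} g p"
  proof -
    have "{R<..\<rho>} \<subseteq> {R..\<rho>}" by auto
    then show ?thesis using ivp unfolding shrinker_ivp_def
      by (auto split: if_splits intro: shrinker_solution_on_subset)
  qed
  show "g R = 0" using ivp by (simp add: shrinker_ivp_def)
  show "continuous_on {R..\<rho>} g"
  proof (cases "C = \<infinity>")
    case False
    then have "shrinker_solution_on n {R..\<rho>} g p" using ivp by (simp add: shrinker_ivp_def)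
    then show ?thesis unfolding shrinker_solution_on_def by (meson DERIV_continuous_on)
  qed (use ivp in \<open>simp add: shrinker_ivp_def\<close>)
  let ?T = "\<lambda>r. if r = R then start_angle C else pi/2 - arctan (p r)"
  show "continuous_on {R..\<rho>} ?T"
  proof (cases "C = \<infinity>")
    case False
    then have s: "shrinker_solution_on n {R..\<rho>} g p" and pR: "ereal (p R) = C"
      using ivp by (auto simp: shrinker_ivp_def)
    from s have "continuous_on {R..\<rho>} p"
      unfolding shrinker_solution_on_def continuous_on_eq_continuous_within
      by (meson DERIV_continuous)
    then have "continuous_on {R..\<rho>} (\<lambda>r. pi/2 - arctan (p r))" by (intro continuous_intros)
    moreover have "start_angle C = pi/2 - arctan (p R)" using pR by (auto simp: start_angle_def)
    ultimately show ?thesis by (elim continuous_on_eq) auto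
  next
    case True
    show ?thesis
      unfolding continuous_on_eq_continuous_within
    proof
      fix r assume r: "r \<in> {R..\<rho>}"
      show "continuous (at r within {R..\<rho>}) ?T"
      proof (cases "r = R")
        case True
        have "filterlim p at_top (at_right R)" using ivp \<open>C = \<infinity>\<close> by (simp add: shrinker_ivp_def)
        from filterlim_compose[OF tendsto_arctan_at_top this]
        have "((\<lambda>r. pi/2 - arctan (p r)) \<longlongrightarrow> pi/2 - pi/2) (at_right R)" by (intro tendsto_intros)
        then have "((\<lambda>r. pi/2 - arctan (p r)) \<longlongrightarrow> start_angle C) (at_right R)"
          using \<open>C = \<infinity>\<close> by (simp add: start_angle_def)
        then have "((\<lambda>r. pi/2 - arctan (p r)) \<longlongrightarrow> start_angle C) (at R within {R..\<rho>})"
          using \<open>R < \<rho>\<close> by (simp add: at_within_Icc_at_right)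
        then have "(?T \<longlongrightarrow> start_angle C) (at R within {R..\<rho>})"
          by (rule Lim_transform_eventually) (auto simp: eventually_at_filter)
        then show ?thesis using True by (simp add: continuous_within)
      next
        case False
        then have rr: "r \<in> {R<..\<rho>}" using r by auto
        then obtain q where "(p has_real_derivative q) (at r within {R<..\<rho>})"
          using sol unfolding shrinker_solution_on_def by blast
        then have "continuous (at r within {R<..\<rho>}) p" by (rule DERIV_continuous)
        then have c: "continuous (at r within {R<..\<rho>}) (\<lambda>r. pi/2 - arctan (p r))"
          by (intro continuous_intros)
        have "at r within {R..\<rho>} = at r within {R<..\<rho>}"
          by (rule at_within_nhd[of _ "{R<..}"]) (use rr in auto)
        with c have "((\<lambda>r. pi/2 - arctan (p r)) \<longlongrightarrow> pi/2 - arctan (p r)) (at r within {R..\<rho>})"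
          by (simp add: continuous_within)
        moreover have "\<forall>\<^sub>F u in at r within {R..\<rho>}. pi/2 - arctan (p u) = ?T u"
          unfolding eventually_at_topological using rr by (intro exI[of _ "{R<..}"]) auto
        ultimately have "(?T \<longlongrightarrow> pi/2 - arctan (p r)) (at r within {R..\<rho>})"
          by (rule Lim_transform_eventually)
        then show ?thesis using False by (simp add: continuous_within)
      qed
    qed
  qed
qed

locale shrinker_profile = shrinker_region +
  fixes n :: nat
  assumes zero_notin: "0 \<notin> D"
    and b_eq: "\<And>r. r \<in> D \<Longrightarrow> b r = (real n - 1) / r - r / 2"
begin

text \<open>As a function of \<open>r\<close> the angle has derivative
  \<open>b p + g / 2 > 0\<close>, so it can be inverted; with \<open>p = cos t / sin t\<close> the
  reciprocal of this derivative is \<open>sin t / \<kappa>\<close>. The slope at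
  \<open>\<rho>\<close> need not vanish, so that portions cut off at the line are covered as
  well.\<close>

lemma ivp_angle_solution:
  assumes ivp: "shrinker_ivp n C R \<rho> g p" and C: "0 < C" and "R < \<rho>" and RD: "R \<in> D" "\<rho> \<in> D"
    and nonneg: "\<And>r. r \<in> {R<..\<rho>} \<Longrightarrow> 0 \<le> g r" "\<And>r. r \<in> {R<..\<rho>} \<Longrightarrow> 0 \<le> p r"
  obtains r x where "angle_solution (start_angle C) (pi/2 - arctan (p \<rho>)) R r x"
    "r (pi/2 - arctan (p \<rho>)) = \<rho>" "x (pi/2 - arctan (p \<rho>)) = g \<rho>"
    "start_angle C < pi/2 - arctan (p \<rho>)"
proof -
  note cs = shrinker_ivp_cases[OF ivp C \<open>R < \<rho>\<close>]
  define T where "T r = (if r = R then start_angle C else pi/2 - arctan (p r))" for r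
  have T_cont: "continuous_on {R..\<rho>} T" using cs(4) by (simp add: T_def)
  have rD: "r \<in> D" if "r \<in> {R..\<rho>}" for r using between_in_D[OF RD] that by auto
  have g_deriv: "(g has_real_derivative p r) (at r)" if r: "r \<in> {R<..<\<rho>}" for r
  proof -
    have "(g has_real_derivative p r) (at r within {R<..\<rho>})"
      using cs(1) r unfolding shrinker_solution_on_def by auto
    then show ?thesis using r at_within_interior[of r "{R<..\<rho>}"] by simp
  qed
  have p_deriv: "\<exists>q. (p has_real_derivative q) (at r) \<and> q / (1 + (p r)\<^sup>2) = - (b r * p r + g r / 2)"
    if r: "r \<in> {R<..<\<rho>}" for r
  proof -
    obtain q where "(p has_real_derivative q) (at r within {R<..\<rho>})"
      "q / (1 + (p r)\<^sup>2) = (r / 2 - (real n - 1) / r) * p r - g r / 2"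
      using cs(1) r unfolding shrinker_solution_on_def by force
    moreover have "r / 2 - (real n - 1) / r = - b r" using b_eq rD[of r] r by simp
    moreover have "at r within {R<..\<rho>} = at r" using r at_within_interior[of r "{R<..\<rho>}"] by simp
    ultimately show ?thesis by (intro exI[of _ q]) (simp add: algebra_simps)
  qed
  have sa: "0 \<le> start_angle C" "start_angle C < pi/2" by (rule start_angle_bounds[OF C])+
  obtain d where d: "d > 0" "\<And>r. r \<in> {R..\<rho>} \<Longrightarrow> \<bar>r - R\<bar> < d \<Longrightarrow> 0 < pi/2 - T r"
  proof (rule continuous_on_pos_nearby)
    show "continuous_on {R..\<rho>} (\<lambda>r. pi/2 - T r)" by (intro continuous_intros T_cont)
    show "0 < pi/2 - T R" using sa by (simp add: T_def)
  qed (use \<open>R < \<rho>\<close> in auto)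
  have p_pos: "p r > 0" if "r \<in> {R<..\<rho>}" "r < R + d" for r
    using d(2)[of r] that by (auto simp: T_def split: if_splits)
  \<comment> \<open>The slope is only known to be nonnegative. Near \<open>R\<close> the angle is
    still below \<open>pi/2\<close>, so the slope is strictly positive there; this lifts
    \<open>g\<close> above \<open>0\<close> and it never falls again.\<close>
  have g_pos: "g r > 0" if r: "r \<in> {R<..\<rho>}" for r
  proof -
    define u where "u = min r (R + d/2)"
    have u: "R < u" "u \<le> r" "u < R + d" using r d(1) by (auto simp: u_def)
    have "g R < g u"
    proof (rule DERIV_pos_imp_increasing_open[of R u g])
      show "continuous_on {R..u} g" by (rule continuous_on_subset[OF cs(2)]) (use u r in auto)
      fix v assume "R < v" "v < u"
      then show "\<exists>y. (g has_real_derivative y) (at v) \<and> 0 < y"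
        using u r by (intro exI[of _ "p v"] conjI g_deriv p_pos) auto
    qed (use u in auto)
    moreover have "g u \<le> g r"
    proof (rule DERIV_nonneg_imp_increasing_open[of u r g])
      show "continuous_on {u..r} g" by (rule continuous_on_subset[OF cs(2)]) (use u r in auto)
      fix v assume "u < v" "v < r"
      then show "\<exists>y. (g has_real_derivative y) (at v) \<and> 0 \<le> y"
        using u r by (intro exI[of _ "p v"] conjI g_deriv nonneg) auto
    qed (use u in auto)
    ultimately show ?thesis using cs(3) by simp
  qed
  have T_deriv: "(T has_real_derivative b r * p r + g r / 2) (at r)" if r: "r \<in> {R<..<\<rho>}" for r
  proof -
    obtain q where q: "(p has_real_derivative q) (at r)" "q / (1 + (p r)\<^sup>2) = - (b r * p r + g r / 2)"
      using p_deriv[OF r] by blast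
    have "((\<lambda>r. pi/2 - arctan (p r)) has_real_derivative - (inverse (1 + (p r)\<^sup>2) * q)) (at r)"
      by (rule DERIV_cong[OF DERIV_diff[OF DERIV_const DERIV_chain2[OF DERIV_arctan q(1)]]]) simp
    moreover have "- (inverse (1 + (p r)\<^sup>2) * q) = b r * p r + g r / 2"
      unfolding minus_equation_iff[of "inverse (1 + (p r)\<^sup>2) * q"] q(2)[symmetric]
      by (simp add: divide_inverse)
    ultimately have "((\<lambda>r. pi/2 - arctan (p r)) has_real_derivative b r * p r + g r / 2) (at r)" by simp
    then show ?thesis
    proof (rule has_field_derivative_transform_within_open)
      show "open {R<..<\<rho>}" by simp
    qed (use r in \<open>auto simp: T_def\<close>)
  qed
  have T'_pos: "b r * p r + g r / 2 > 0" if r: "r \<in> {R<..\<rho>}" for r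
    using g_pos[OF r] nonneg(2)[OF r] b_pos[OF rD[of r]] r by (intro add_nonneg_pos) auto
  have T_mono: "T r < T r'" if "R \<le> r" "r < r'" "r' \<le> \<rho>" for r r'
  proof (rule DERIV_pos_imp_increasing_open[of r r' T])
    show "continuous_on {r..r'} T" by (rule continuous_on_subset[OF T_cont]) (use that in auto)
    fix u assume "r < u" "u < r'"
    then show "\<exists>y. (T has_real_derivative y) (at u) \<and> 0 < y"
      using that by (intro exI[of _ "b u * p u + g u / 2"] conjI T_deriv T'_pos) auto
  qed (use that in auto)
  have inj: "inj_on T {R..\<rho>}"
    by (rule linorder_inj_onI') (use T_mono in force)
  define t1 where "t1 = pi/2 - arctan (p \<rho>)"
  have TR: "T R = start_angle C" "T \<rho> = t1" using \<open>R < \<rho>\<close> by (auto simp: T_def t1_def)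
  have t1: "start_angle C < t1" using T_mono[of R \<rho>] TR \<open>R < \<rho>\<close> by simp
  have t1_le: "t1 \<le> pi/2" using nonneg(2)[of \<rho>] \<open>R < \<rho>\<close> by (simp add: t1_def)
  have img: "T ` {R..\<rho>} = {start_angle C..t1}"
  proof
    show "T ` {R..\<rho>} \<subseteq> {start_angle C..t1}"
    proof
      fix y assume "y \<in> T ` {R..\<rho>}"
      then obtain r where r: "r \<in> {R..\<rho>}" "y = T r" by blast
      have "T R \<le> T r" "T r \<le> T \<rho>"
        using T_mono[of R r] T_mono[of r \<rho>] r by (cases "r = R"; cases "r = \<rho>"; force)+
      then show "y \<in> {start_angle C..t1}" using TR r by auto
    qed
    show "{start_angle C..t1} \<subseteq> T ` {R..\<rho>}"
    proof
      fix y assume "y \<in> {start_angle C..t1}"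
      then obtain r where "R \<le> r" "r \<le> \<rho>" "T r = y"
        using IVT'[of T R y \<rho>] TR T_cont \<open>R < \<rho>\<close> by auto
      then show "y \<in> T ` {R..\<rho>}" by auto
    qed
  qed
  define r where "r = inv_into {R..\<rho>} T"
  have rT: "r (T u) = u" if "u \<in> {R..\<rho>}" for u unfolding r_def using inj that by simp
  have Tr: "T (r t) = t" "r t \<in> {R..\<rho>}" if "t \<in> {start_angle C..t1}" for t
    unfolding r_def using that img f_inv_into_f[of t T "{R..\<rho>}"] inv_into_into[of t T "{R..\<rho>}"]
    by blast+
  have r_cont: "continuous_on {start_angle C..t1} r"
    using continuous_on_inv[OF T_cont compact_Icc, of r] rT img by simp
  define x where "x t = g (r t)" for t
  have r_range: "r t \<in> {R<..<\<rho>}" if t: "t \<in> {start_angle C<..<t1}" for t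
    using Tr[of t] t TR by (metis atLeastAtMost_iff greaterThanLessThan_iff less_eq_real_def less_irrefl)
  have p_eq: "p (r t) = cos t / sin t" "sin t > 0" if t: "t \<in> {start_angle C<..<t1}" for t
  proof -
    have "arctan (p (r t)) = pi/2 - t" using Tr[of t] r_range[OF t] t by (auto simp: T_def)
    then have "p (r t) = tan (pi/2 - t)" by (metis arctan tan_arctan)
    then show "p (r t) = cos t / sin t" by (simp add: tan_def cos_diff sin_diff)
    show "sin t > 0" using t t1_le sa by (intro sin_gt_zero) auto
  qed
  have r_deriv: "(r has_real_derivative sin t / curv t (r t) (x t)) (at t)"
    if t: "t \<in> {start_angle C<..<t1}" for t
  proof -
    have 1: "(T has_real_derivative b (r t) * p (r t) + g (r t) / 2) (at (r t))"
      by (rule T_deriv[OF r_range[OF t]])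
    have pos: "b (r t) * p (r t) + g (r t) / 2 > 0" by (rule T'_pos) (use r_range[OF t] in auto)
    have "(r has_real_derivative inverse (b (r t) * p (r t) + g (r t) / 2)) (at t)"
    proof (rule has_field_derivative_inverse_basic[where f = T and g = r and y = t, OF 1])
      show "continuous (at t) r"
        using continuous_on_interior[OF r_cont] t by simp
      show "open {start_angle C<..<t1}" "t \<in> {start_angle C<..<t1}" using t by auto
      show "T (r z) = z" if "z \<in> {start_angle C<..<t1}" for z using Tr that by auto
    qed (use pos in simp)
    moreover have "b (r t) * p (r t) + g (r t) / 2 = curv t (r t) (x t) / sin t"
      using p_eq[OF t] by (simp add: curv_def x_def field_simps)
    ultimately show ?thesis by simp
  qed
  have "angle_solution (start_angle C) t1 R r x"
    unfolding angle_solution_def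
  proof (intro conjI ballI)
    show "continuous_on {start_angle C..t1} x" unfolding x_def
      by (rule continuous_on_compose2[OF cs(2) r_cont]) (use Tr in auto)
    show rR: "r (start_angle C) = R" using rT[of R] TR \<open>R < \<rho>\<close> by simp
    show "x (start_angle C) = 0" unfolding x_def rR by (rule cs(3))
    show "r t \<in> D" if "t \<in> {start_angle C..t1}" for t using rD Tr(2)[OF that] by simp
    show "0 < x t" if t: "t \<in> {start_angle C<..t1}" for t
    proof -
      have "r t \<noteq> R" using Tr(1)[of t] TR t by auto
      then show ?thesis unfolding x_def using Tr(2)[of t] t by (intro g_pos) auto
    qed
    fix t assume t: "t \<in> {start_angle C<..<t1}"
    show "(r has_real_derivative sin t / curv t (r t) (x t)) (at t)" by (rule r_deriv[OF t])
    show "(x has_real_derivative cos t / curv t (r t) (x t)) (at t)" unfolding x_def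
      by (rule DERIV_cong[OF DERIV_chain2[OF g_deriv[OF r_range[OF t]] r_deriv[OF t]]])
        (use p_eq[OF t] in \<open>simp add: x_def\<close>)
  qed (rule r_cont)
  moreover have "r t1 = \<rho>" using rT[of \<rho>] TR \<open>R < \<rho>\<close> by simp
  ultimately show ?thesis using that[of r x] t1 by (simp add: t1_def x_def)
qed

text \<open>The converse passage inverts the increasing function \<open>r\<close>: the graph is
  \<open>g = x \<circ> \<tau>\<close> with slope the cotangent of \<open>\<tau>\<close>. The
  one-sided derivatives at the ends of the angle interval yield the equation at
  \<open>\<rho>\<close> and, for finite \<open>C\<close>, at \<open>R\<close>.\<close>

lemma angle_solution_horizontal_point:
  assumes C: "0 < C" and sol: "angle_solution (start_angle C) (pi/2) R r x"
    and r_deriv: "\<And>t. t \<in> {start_angle C..pi/2} \<Longrightarrow>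
      (r has_real_derivative sin t / curv t (r t) (x t)) (at t within {start_angle C..pi/2})"
    and x_deriv: "\<And>t. t \<in> {start_angle C..pi/2} \<Longrightarrow>
      (x has_real_derivative cos t / curv t (r t) (x t)) (at t within {start_angle C..pi/2})"
  shows "horizontal_point n C R (r (pi/2), x (pi/2))"
proof -
  note s = angle_solutionD[OF sol]
  have t0: "0 \<le> start_angle C" "start_angle C < pi/2" by (rule start_angle_bounds[OF C])+
  define t0 where "t0 = start_angle C"
  note t0 = t0[folded t0_def] and s = s[folded t0_def] and sol = sol[folded t0_def]
    and r_deriv = r_deriv[folded t0_def] and x_deriv = x_deriv[folded t0_def]
  define \<rho> where "\<rho> = r (pi/2)"
  have mono: "r t < r t'" if "t0 \<le> t" "t < t'" "t' \<le> pi/2" for t t'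
    by (rule angle_solution_strict_increasing[OF sol t0 order_refl that])
  have "R < \<rho>" using mono[of t0 "pi/2"] t0 s(3) by (simp add: \<rho>_def)
  have inj: "inj_on r {t0..pi/2}"
    by (rule linorder_inj_onI') (use mono in force)
  have img: "r ` {t0..pi/2} = {R..\<rho>}"
  proof
    show "r ` {t0..pi/2} \<subseteq> {R..\<rho>}"
    proof
      fix y assume "y \<in> r ` {t0..pi/2}"
      then obtain t where t: "t \<in> {t0..pi/2}" "y = r t" by blast
      have "r t0 \<le> r t" "r t \<le> \<rho>" unfolding \<rho>_def
        using mono[of t0 t] mono[of t "pi/2"] t by (cases "t = t0"; cases "t = pi/2"; force)+
      then show "y \<in> {R..\<rho>}" using s(3) t by auto
    qed
    show "{R..\<rho>} \<subseteq> r ` {t0..pi/2}"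
    proof
      fix y assume "y \<in> {R..\<rho>}"
      then obtain t where "t0 \<le> t" "t \<le> pi/2" "r t = y"
        using IVT'[of r t0 y "pi/2"] s(1,3) t0 by (auto simp: \<rho>_def)
      then show "y \<in> r ` {t0..pi/2}" by auto
    qed
  qed
  define \<tau> where "\<tau> = inv_into {t0..pi/2} r"
  have \<tau>r: "\<tau> (r t) = t" if "t \<in> {t0..pi/2}" for t unfolding \<tau>_def using inj that by simp
  have r\<tau>: "r (\<tau> u) = u" "\<tau> u \<in> {t0..pi/2}" if "u \<in> {R..\<rho>}" for u
    unfolding \<tau>_def using that img f_inv_into_f[of u r "{t0..pi/2}"] inv_into_into[of u r "{t0..pi/2}"]
    by blast+
  have \<tau>_cont: "continuous_on {R..\<rho>} \<tau>"
    using continuous_on_inv[OF s(1) compact_Icc, of \<tau>] \<tau>r img by simp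
  have \<tau>R: "\<tau> R = t0" "\<tau> \<rho> = pi/2" using \<tau>r[of t0] \<tau>r[of "pi/2"] s(3) t0 by (auto simp: \<rho>_def)
  define g p where "g u = x (\<tau> u)" and "p u = tan (pi/2 - \<tau> u)" for u
  \<comment> \<open>\<open>0 < t0\<close> is the case of finite \<open>C\<close>, where the equation
    is required at \<open>R\<close> too. For \<open>C = \<infinity>\<close> the cotangent is
    infinite at \<open>R\<close>, and that point has to be left out.\<close>
  have sin_pos: "sin (\<tau> u) > 0" if "u \<in> {R..\<rho>}" "R < u \<or> 0 < t0" for u
  proof -
    have "0 < \<tau> u"
      using r\<tau>[OF that(1)] that(2) t0 s(3) by (cases "\<tau> u = t0") auto
    then show ?thesis using r\<tau>(2)[OF that(1)] by (intro sin_gt_zero) auto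
  qed
  have p_eq: "p u = cos (\<tau> u) / sin (\<tau> u)" for u
    by (simp add: p_def tan_def cos_diff sin_diff)
  have ode: "(g has_real_derivative p u) (at u within {R..\<rho>}) \<and>
     (\<exists>q. (p has_real_derivative q) (at u within {R..\<rho>}) \<and>
       q / (1 + (p u)\<^sup>2) = (u / 2 - (real n - 1) / u) * p u - g u / 2)"
    if u: "u \<in> {R..\<rho>}" "R < u \<or> 0 < t0" for u
  proof -
    define \<kappa> where "\<kappa> = curv (\<tau> u) u (g u)"
    have sp: "sin (\<tau> u) > 0" by (rule sin_pos[OF u])
    have kp: "\<kappa> > 0" unfolding \<kappa>_def g_def
      using angle_solution_curv_pos[OF sol t0 order_refl r\<tau>(2)[OF u(1)]] r\<tau>(1)[OF u(1)] by simp
    have \<tau>_deriv: "(\<tau> has_real_derivative \<kappa> / sin (\<tau> u)) (at u within {R..\<rho>})"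
    proof -
      have "(\<tau> has_real_derivative inverse (sin (\<tau> u) / \<kappa>)) (at (r (\<tau> u)) within r ` {t0..pi/2})"
      proof (rule DERIV_inverse_within[OF _ _ inj r\<tau>(2)[OF u(1)] \<tau>r])
        show "(r has_real_derivative sin (\<tau> u) / \<kappa>) (at (\<tau> u) within {t0..pi/2})"
          using r_deriv[OF r\<tau>(2)[OF u(1)]] r\<tau>(1)[OF u(1)] by (simp add: \<kappa>_def g_def)
        show "continuous (at (r (\<tau> u)) within r ` {t0..pi/2}) \<tau>"
          using \<tau>_cont u(1) r\<tau>(1)[OF u(1)] img by (simp add: continuous_on_eq_continuous_within)
      qed (use sp kp in auto)
      then show ?thesis using r\<tau>(1)[OF u(1)] img by simp
    qed
    have img': "\<tau> ` {R..\<rho>} = {t0..pi/2}" using \<tau>r by (force simp flip: img)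
    have "(x \<circ> \<tau> has_real_derivative cos (\<tau> u) / \<kappa> * (\<kappa> / sin (\<tau> u))) (at u within {R..\<rho>})"
      by (rule DERIV_image_chain[OF _ \<tau>_deriv])
        (use x_deriv[OF r\<tau>(2)[OF u(1)]] r\<tau>(1)[OF u(1)] in \<open>simp add: img' \<kappa>_def g_def\<close>)
    then have 1: "(g has_real_derivative p u) (at u within {R..\<rho>})"
      using kp by (simp add: p_eq g_def[abs_def] comp_def)
    have cs: "cos (pi/2 - \<tau> u) = sin (\<tau> u)" by (simp add: cos_diff)
    have "cos (pi/2 - \<tau> u) \<noteq> 0" using sp cs by simp
    then have "(p has_real_derivative inverse ((cos (pi/2 - \<tau> u))\<^sup>2) * (0 - \<kappa> / sin (\<tau> u))) (at u within {R..\<rho>})"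
      unfolding p_def by (intro DERIV_chain2[OF DERIV_tan] DERIV_diff DERIV_const \<tau>_deriv)
    then have 2: "(p has_real_derivative - (\<kappa> / (sin (\<tau> u))^3)) (at u within {R..\<rho>})"
      unfolding cs
      by (rule DERIV_cong) (use sp in \<open>simp add: field_simps power2_eq_square power3_eq_cube\<close>)
    have "1 + (p u)\<^sup>2 = 1 / (sin (\<tau> u))\<^sup>2"
      using sp by (simp add: p_eq power_divide field_simps)
    then have "- (\<kappa> / (sin (\<tau> u))^3) / (1 + (p u)\<^sup>2) = - (\<kappa> / sin (\<tau> u))"
      using sp by (simp add: field_simps power2_eq_square power3_eq_cube)
    also have "\<dots> = - (b u * p u) - g u / 2"
      using sp by (simp add: \<kappa>_def curv_def p_eq field_simps)
    also have "b u = (real n - 1) / u - u / 2"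
      using b_eq s(5)[OF r\<tau>(2)[OF u(1)]] r\<tau>(1)[OF u(1)] by simp
    finally have "- (\<kappa> / (sin (\<tau> u))^3) / (1 + (p u)\<^sup>2) = (u / 2 - (real n - 1) / u) * p u - g u / 2"
      by (simp add: algebra_simps)
    with 1 2 show ?thesis by blast
  qed
  have "g R = 0" by (simp add: g_def \<tau>R s)
  have g_cont: "continuous_on {R..\<rho>} g" unfolding g_def
    by (rule continuous_on_compose2[OF s(2) \<tau>_cont]) (use r\<tau> in auto)
  have ivp: "shrinker_ivp n C R \<rho> g p"
  proof (cases "C = \<infinity>")
    case True
    then have "t0 = 0" by (simp add: t0_def start_angle_def)
    have "shrinker_solution_on n {R<..\<rho>} g p"
      unfolding shrinker_solution_on_def
    proof
      fix u assume u: "u \<in> {R<..\<rho>}"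
      have sub: "{R<..\<rho>} \<subseteq> {R..\<rho>}" by auto
      show "(g has_real_derivative p u) (at u within {R<..\<rho>}) \<and>
        (\<exists>q. (p has_real_derivative q) (at u within {R<..\<rho>}) \<and>
          q / (1 + (p u)\<^sup>2) = (u / 2 - (real n - 1) / u) * p u - g u / 2)"
        using ode[of u] u DERIV_subset[OF _ sub] by fastforce
    qed
    moreover have "filterlim p at_top (at_right R)"
      unfolding p_def
    proof (rule filterlim_compose[OF filterlim_tan_at_left])
      have "(\<tau> \<longlongrightarrow> 0) (at_right R)"
        using \<tau>_cont \<tau>R(1) \<open>t0 = 0\<close> \<open>R < \<rho>\<close>
        by (metis atLeastAtMost_iff at_within_Icc_at_right continuous_on less_eq_real_def order_refl)
      then have "((\<lambda>u. pi/2 - \<tau> u) \<longlongrightarrow> pi/2 - 0) (at_right R)" by (intro tendsto_intros)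
      moreover have "\<forall>\<^sub>F u in at_right R. pi/2 - \<tau> u < pi/2"
      proof -
        have "\<forall>\<^sub>F u in at_right R. u < \<rho>" using \<open>R < \<rho>\<close> by (rule eventually_at_right_real[THEN eventually_mono]) auto
        moreover have "\<forall>\<^sub>F u in at_right R. R < u" by (simp add: eventually_at_right_less)
        ultimately show ?thesis
        proof eventually_elim
          case (elim u)
          then have "u \<in> {R..\<rho>}" by auto
          then show ?case using r\<tau>[of u] elim s(3) \<open>t0 = 0\<close> by (cases "\<tau> u = 0") auto
        qed
      qed
      ultimately show "filterlim (\<lambda>u. pi/2 - \<tau> u) (at_left (pi/2)) (at_right R)"
        by (simp add: filterlim_at eventually_mono)
    qed
    ultimately show ?thesis using True g_cont \<open>g R = 0\<close> by (simp add: shrinker_ivp_def)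
  next
    case False
    then obtain c where c: "C = ereal c" "c > 0" using C by (cases C) auto
    then have "t0 = pi/2 - arctan c" by (simp add: t0_def start_angle_def)
    then have "0 < t0" "p R = c" using arctan_ubound[of c] by (auto simp: p_def \<tau>R tan_arctan)
    then show ?thesis using False ode c \<open>g R = 0\<close>
      by (simp add: shrinker_ivp_def shrinker_solution_on_def)
  qed
  have "0 \<le> g u \<and> 0 \<le> p u" if u: "u \<in> {R<..\<rho>}" for u
  proof
    have uI: "u \<in> {R..\<rho>}" using u by auto
    show "0 \<le> g u" unfolding g_def by (rule s(7)[OF r\<tau>(2)[OF uI]])
    have "0 \<le> cos (\<tau> u)" using r\<tau>(2)[OF uI] t0 by (intro cos_ge_zero) auto
    then show "0 \<le> p u" using sin_pos[OF uI] u by (simp add: p_eq)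
  qed
  moreover have "p \<rho> = 0" "g \<rho> = x (pi/2)" by (auto simp: p_def g_def \<tau>R)
  \<comment> \<open>Otherwise \<open>0\<close> would lie between two points of the interval
    \<open>D\<close>.\<close>
  moreover have "\<rho> < 0" if "R < 0"
    using between_in_D[of R \<rho> 0] s(3) s(5)[of t0] s(5)[of "pi/2"] t0 that zero_notin
    by (force simp: \<rho>_def)
  ultimately show ?thesis unfolding horizontal_point_def using \<open>R < \<rho>\<close> ivp
    unfolding prod.case \<rho>_def[symmetric] by blast
qed

end

section \<open>Uniqueness and existence\<close>

lemma reciprocal_lipschitz:
  fixes u v \<epsilon> :: real
  assumes "0 < \<epsilon>" "\<epsilon> \<le> u" "\<epsilon> \<le> v" "\<bar>c\<bar> \<le> 1"
  shows "\<bar>c / u - c / v\<bar> \<le> \<bar>u - v\<bar> / \<epsilon>\<^sup>2"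
proof -
  have "\<bar>c / u - c / v\<bar> = \<bar>c\<bar> * \<bar>u - v\<bar> / (u * v)"
    using assms by (simp add: diff_frac_eq abs_mult flip: right_diff_distrib) (simp add: abs_minus_commute)
  also have "\<dots> \<le> 1 * \<bar>u - v\<bar> / (\<epsilon> * \<epsilon>)"
    using assms by (intro frac_le mult_mono mult_right_mono) auto
  finally show ?thesis by (simp add: power2_eq_square)
qed

lemma norm_Pair_le_of_components:
  fixes a b :: real
  assumes "\<bar>a\<bar> \<le> c" "\<bar>b\<bar> \<le> c"
  shows "norm (a, b) \<le> 2 * c"
  using norm_Pair_le[of a b] assms by simp

text \<open>After the last point with \<open>f \<ge> 0\<close> the function would be negative and
  nondecreasing, so it could not end below \<open>0\<close>. This is the barrier argument for the
  lower bound on the heights.\<close>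

lemma nonneg_if_deriv_nonneg_where_neg:
  fixes f :: "real \<Rightarrow> real"
  assumes cont: "continuous_on {a..b} f" and "a \<le> b" "0 \<le> f a"
    and der: "\<And>t. t \<in> {a<..<b} \<Longrightarrow> f t < 0 \<Longrightarrow> \<exists>y\<ge>0. (f has_real_derivative y) (at t)"
  shows "0 \<le> f b"
proof (rule ccontr)
  assume neg: "\<not> 0 \<le> f b"
  define S where "S = {a..b} \<inter> f -` {0..}"
  have S: "closed S" "a \<in> S" "bdd_above S"
    unfolding S_def using assms by (auto simp: continuous_closed_preimage intro!: bdd_aboveI[of _ b])
  define s where "s = Sup S"
  have sS: "s \<in> S" unfolding s_def by (rule closed_contains_Sup) (use S in auto)
  have neg_after: "f t < 0" if "s < t" "t \<le> b" for t
  proof (rule ccontr)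
    assume "\<not> f t < 0"
    then have "t \<in> S" using that sS by (auto simp: S_def)
    then have "t \<le> s" unfolding s_def using S by (intro cSup_upper) auto
    then show False using that by simp
  qed
  have "f s \<le> f b"
  proof (rule DERIV_nonneg_imp_increasing_open[of s b f])
    show "continuous_on {s..b} f" by (rule continuous_on_subset[OF cont]) (use sS in \<open>auto simp: S_def\<close>)
    show "s \<le> b" using sS by (simp add: S_def)
    fix t assume "s < t" "t < b"
    then show "\<exists>y. (f has_real_derivative y) (at t) \<and> 0 \<le> y"
      using der[of t] neg_after[of t] sS by (auto simp: S_def)
  qed
  then show False using sS neg by (simp add: S_def)
qed

context shrinker_region begin

lemma b_lipschitz:
  assumes "R \<in> D"
  obtains M where "0 \<le> M" "\<And>u v. u \<in> {R..e} \<Longrightarrow> v \<in> {R..e} \<Longrightarrow> \<bar>b u - b v\<bar> \<le> M * \<bar>u - v\<bar>"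
proof -
  have sub: "{R..e} \<subseteq> D" using between_in_D[OF assms e_in] by auto
  have "compact (A ` {R..e})"
    by (rule compact_continuous_image[OF continuous_on_subset[OF A_cont sub]]) simp
  then obtain M where M: "M > 0" "\<And>u. u \<in> {R..e} \<Longrightarrow> \<bar>A u\<bar> \<le> M"
    using compact_imp_bounded bounded_pos by (metis image_eqI real_norm_def)
  have "(b has_real_derivative - A u) (at u within {R..e})" if "u \<in> {R..e}" for u
    using that sub by (intro has_field_derivative_at_within[OF b_deriv]) auto
  then have "\<bar>b u - b v\<bar> \<le> M * \<bar>u - v\<bar>" if "u \<in> {R..e}" "v \<in> {R..e}" for u v
    using field_differentiable_bound[of "{R..e}" b "\<lambda>u. - A u" M u v] that M by simp
  with M(1) show ?thesis by (intro that[of M]) auto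
qed

lemma angle_solution_restrict:
  assumes "angle_solution t0 t1 R r x" "t1' \<le> t1"
  shows "angle_solution t0 t1' R r x"
  using assms unfolding angle_solution_def
  by (auto intro: continuous_on_subset[of "{t0..t1}"])

text \<open>On the compact interval both curvatures have a common positive lower bound, so the
  right-hand side is Lipschitz along the two solutions and the Gronwall estimate applies to their
  difference.\<close>

lemma angle_solution_unique:
  assumes t0: "0 \<le> t0" "t0 < pi/2" and "t0 \<le> t1" "t1 \<le> pi/2"
    and sol1: "angle_solution t0 t1 R r1 x1" and sol2: "angle_solution t0 t1 R r2 x2"
  shows "r1 t1 = r2 t1 \<and> x1 t1 = x2 t1"
proof -
  note s1 = angle_solutionD[OF sol1] and s2 = angle_solutionD[OF sol2]
  define k1 k2 where "k1 t = curv t (r1 t) (x1 t)" and "k2 t = curv t (r2 t) (x2 t)" for t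
  have k_pos: "0 < k1 t" "0 < k2 t" if "t \<in> {t0..t1}" for t
    unfolding k1_def k2_def
    using angle_solution_curv_pos[OF sol1 t0 \<open>t1 \<le> pi/2\<close> that]
      angle_solution_curv_pos[OF sol2 t0 \<open>t1 \<le> pi/2\<close> that] by auto
  have "continuous_on {t0..t1} (\<lambda>t. min (k1 t) (k2 t))"
    unfolding k1_def k2_def
    by (intro continuous_intros angle_solution_curv_cont[OF sol1] angle_solution_curv_cont[OF sol2])
  from continuous_attains_inf[OF compact_Icc _ this]
  obtain \<epsilon> where eps: "0 < \<epsilon>" "\<And>t. t \<in> {t0..t1} \<Longrightarrow> \<epsilon> \<le> k1 t" "\<And>t. t \<in> {t0..t1} \<Longrightarrow> \<epsilon> \<le> k2 t"
    using k_pos \<open>t0 \<le> t1\<close> by (metis atLeastatMost_empty_iff2 leD min.bounded_iff min_less_iff_conj)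
  have RD: "R \<in> D" using s1(3) s1(5)[of t0] \<open>t0 \<le> t1\<close> by auto
  obtain M where M: "0 \<le> M" "\<And>u v. u \<in> {R..e} \<Longrightarrow> v \<in> {R..e} \<Longrightarrow> \<bar>b u - b v\<bar> \<le> M * \<bar>u - v\<bar>"
    using b_lipschitz[OF RD] by blast
  define d where "d t = (r1 t - r2 t, x1 t - x2 t)" for t
  define d' where "d' t = (sin t / k1 t - sin t / k2 t, cos t / k1 t - cos t / k2 t)" for t
  define L where "L = 2 * ((M + 1) / \<epsilon>\<^sup>2)"
  have "norm (d t1) \<le> exp (L * (t1 - t0)) * norm (d t0)"
  proof (rule gronwall_norm[OF \<open>t0 \<le> t1\<close>, of d d'])
    show "continuous_on {t0..t1} d" unfolding d_def by (intro continuous_intros s1 s2)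
    fix t assume t: "t \<in> {t0<..<t1}"
    then have tI: "t \<in> {t0..t1}" by auto
    show "(d has_vector_derivative d' t) (at t)"
      unfolding d_def d'_def k1_def k2_def
      by (intro has_vector_derivative_Pair has_vector_derivative_diff)
        (use s1(8,9)[OF t] s2(8,9)[OF t] in \<open>simp_all add: has_real_derivative_iff_has_vector_derivative\<close>)
    have range: "r1 t \<in> {R..e}" "r2 t \<in> {R..e}"
      using angle_solution_strict_increasing[OF sol1 t0 \<open>t1 \<le> pi/2\<close>, of t0 t]
        angle_solution_strict_increasing[OF sol2 t0 \<open>t1 \<le> pi/2\<close>, of t0 t]
        s1(3) s2(3) le_e[OF s1(5)[OF tI]] le_e[OF s2(5)[OF tI]] t by auto
    have half_sin_le: "\<bar>sin t / 2\<bar> \<le> 1" using abs_sin_le_one[of t] unfolding abs_divide by linarith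
    have "\<bar>k1 t - k2 t\<bar> = \<bar>(b (r1 t) - b (r2 t)) * cos t + (x1 t - x2 t) * (sin t / 2)\<bar>"
      by (simp add: k1_def k2_def curv_def algebra_simps diff_divide_distrib)
    also have "\<dots> \<le> \<bar>b (r1 t) - b (r2 t)\<bar> * \<bar>cos t\<bar> + \<bar>x1 t - x2 t\<bar> * \<bar>sin t / 2\<bar>"
      by (rule order_trans[OF abs_triangle_ineq]) (simp add: abs_mult)
    also have "\<dots> \<le> (M * \<bar>r1 t - r2 t\<bar>) * 1 + \<bar>x1 t - x2 t\<bar> * 1"
      using M(2)[OF range] M(1) half_sin_le by (intro add_mono mult_mono) auto
    also have "\<dots> \<le> M * norm (d t) + norm (d t)"
      using norm_fst_le[of "r1 t - r2 t" "x1 t - x2 t"] norm_snd_le[of "x1 t - x2 t" "r1 t - r2 t"] M(1)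
      by (simp add: d_def mult_left_mono add_mono)
    finally have k_diff: "\<bar>k1 t - k2 t\<bar> \<le> (M + 1) * norm (d t)" by (simp add: algebra_simps)
    have comp: "\<bar>c / k1 t - c / k2 t\<bar> \<le> (M + 1) / \<epsilon>\<^sup>2 * norm (d t)" if "\<bar>c\<bar> \<le> 1" for c
    proof -
      have "\<bar>c / k1 t - c / k2 t\<bar> \<le> \<bar>k1 t - k2 t\<bar> / \<epsilon>\<^sup>2"
        by (rule reciprocal_lipschitz) (use eps tI that in auto)
      also have "\<dots> \<le> ((M + 1) * norm (d t)) / \<epsilon>\<^sup>2" by (intro divide_right_mono k_diff) simp
      finally show ?thesis by simp
    qed
    have "norm (d' t) \<le> 2 * ((M + 1) / \<epsilon>\<^sup>2 * norm (d t))"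
      unfolding d'_def by (intro norm_Pair_le_of_components comp) auto
    then show "norm (d' t) \<le> L * norm (d t)" by (simp only: L_def mult.assoc)
  qed
  moreover have "d t0 = 0" using s1(3,4) s2(3,4) by (simp add: d_def zero_prod_def)
  ultimately have "d t1 = 0" by simp
  then show ?thesis by (simp add: d_def zero_prod_def)
qed

text \<open>The one-sided derivatives at \<open>t0\<close> and \<open>pi/2\<close> are what the
  return to a graph needs.\<close>

definition strong_angle_solution :: "real \<Rightarrow> real \<Rightarrow> (real \<Rightarrow> real) \<Rightarrow> (real \<Rightarrow> real) \<Rightarrow> bool" where
  "strong_angle_solution t0 R r x \<longleftrightarrow> angle_solution t0 (pi/2) R r x \<and>
     (\<forall>t\<in>{t0..pi/2}.
        (r has_real_derivative sin t / curv t (r t) (x t)) (at t within {t0..pi/2}) \<and>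
        (x has_real_derivative cos t / curv t (r t) (x t)) (at t within {t0..pi/2}))"

text \<open>The system is made globally Lipschitz by clipping \<open>r\<close> to \<open>{R0..e}\<close> and \<open>x\<close> from below by
  a function \<open>l\<close> that turns out to be a lower bound for all solutions.\<close>
lemma solution_family:
  assumes t0: "0 \<le> t0" "t0 < pi/2" and R0: "R0 \<in> D"
  obtains \<rho> where "continuous_on {R0..e} \<rho>" "\<And>R. R \<in> {R0..e} \<Longrightarrow> R < \<rho> R"
    "\<And>R. R \<in> {R0..e} \<Longrightarrow> \<rho> R \<le> e \<Longrightarrow> \<exists>r x. strong_angle_solution t0 R r x \<and> r (pi/2) = \<rho> R"
    "e < \<rho> R0 \<Longrightarrow> \<exists>t1 r x. t0 \<le> t1 \<and> t1 \<le> pi/2 \<and> angle_solution t0 t1 R0 r x \<and> r t1 = e \<and>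
        (\<forall>t\<in>{t0..t1}. (sin t - sin t0) / (b R0 + 1) \<le> x t)"
proof -
  define I where "I = {t0..pi/2}"
  have sub: "{R0..e} \<subseteq> D" using between_in_D[OF R0 e_in] by auto
  have bR0: "b R0 > 0" by (rule b_pos[OF R0])
  define cl where "cl r = max R0 (min r e)" for r
  have cl: "cl r \<in> {R0..e}" for r using le_e[OF R0] by (auto simp: cl_def)
  have cl_id: "cl r = r" if "R0 \<le> r" "r \<le> e" for r using that by (simp add: cl_def)
  have cl_lip: "\<bar>cl r - cl r'\<bar> \<le> \<bar>r - r'\<bar>" for r r' by (auto simp: cl_def max_def min_def)
  \<comment> \<open>As long as \<open>x\<close> is below this barrier, which is at most
    \<open>1\<close>, the clipped curvature is at most \<open>b R0 + 1\<close>. Hence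
    \<open>x' \<ge> cos t / (b R0 + 1) = l'\<close>, and \<open>x\<close> cannot drop below
    \<open>l\<close>.\<close>
  define l where "l t = (sin t - sin t0) / (b R0 + 1)" for t
  have sin_less: "sin u < sin v" if "t0 \<le> u" "u < v" "v \<le> pi/2" for u v
    using sin_monotone_2pi[of u v] that t0 pi_gt_zero by linarith
  have l_pos: "0 < l t" if "t \<in> {t0<..pi/2}" for t
    using sin_less[of t0 t] that bR0 by (simp add: l_def)
  have l0: "l t0 = 0" by (simp add: l_def)
  have sin_nonneg: "0 \<le> sin t" "0 \<le> cos t" if "t \<in> I" for t
    using that t0 by (auto simp: I_def intro!: sin_ge_zero cos_ge_zero)
  have l_le: "l t \<le> 1" if "t \<in> I" for t
  proof -
    have "sin t - sin t0 \<le> b R0 + 1"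
    proof -
      have "0 \<le> sin t0" using sin_nonneg[of t0] t0 by (simp add: I_def)
      then show ?thesis using sin_le_one[of t] bR0 by linarith
    qed
    then show ?thesis using bR0 by (simp add: l_def)
  qed
  have l_nonneg: "0 \<le> l t" if "t \<in> I" for t
    using l_pos[of t] l0 that by (cases "t = t0") (auto simp: I_def)
  define k where "k t r x = b (cl r) * cos t + max x (l t) * sin t / 2" for t r x
  define f where "f t = (\<lambda>(r, x). (sin t / k t r x, cos t / k t r x))" for t
  \<comment> \<open>Since \<open>b\<close> decreases, clipping bounds the curvature below by
    \<open>b e * cos t + l t * sin t / 2\<close>. The first term is positive before
    \<open>pi/2\<close>, and \<open>l (pi/2) > 0\<close> takes over at \<open>pi/2\<close>.\<close>
  have "\<exists>\<epsilon>>0. \<forall>t\<in>I. \<forall>r x. \<epsilon> \<le> k t r x"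
  proof -
    define m where "m t = b e * cos t + l t * sin t / 2" for t
    have "continuous_on I m" unfolding m_def l_def using bR0 by (intro continuous_intros) auto
    moreover have "0 < m t" if t: "t \<in> I" for t
    proof (cases "t = pi/2")
      case True
      have "0 < l (pi/2)" using l_pos t0 by simp
      then show ?thesis unfolding True m_def by simp
    next
      case False
      then have "0 < cos t" using t t0 by (intro cos_gt_zero_pi) (auto simp: I_def)
      then show ?thesis using b_pos[OF e_in] sin_nonneg[OF t] l_nonneg[OF t]
        by (auto simp: m_def intro!: add_pos_nonneg)
    qed
    ultimately obtain \<epsilon> where "\<epsilon> > 0" "\<And>t. t \<in> I \<Longrightarrow> \<epsilon> \<le> m t"
      using continuous_attains_inf[of I m] t0 unfolding I_def
      by (metis atLeastatMost_empty_iff2 compact_Icc less_eq_real_def linorder_not_less)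
    moreover have "m t \<le> k t r x" if "t \<in> I" for t r x
      unfolding m_def k_def using sin_nonneg[OF that] cl[of r] sub
      by (intro add_mono mult_right_mono divide_right_mono b_decreasing e_in) auto
    ultimately show ?thesis by (meson order_trans)
  qed
  then obtain \<epsilon> where eps: "0 < \<epsilon>" "\<And>t r x. t \<in> I \<Longrightarrow> \<epsilon> \<le> k t r x" by blast
  have k_pos: "0 < k t r x" if "t \<in> I" for t r x using eps(1) eps(2)[OF that] by (rule less_le_trans)
  obtain M where M: "0 \<le> M" "\<And>u v. u \<in> {R0..e} \<Longrightarrow> v \<in> {R0..e} \<Longrightarrow> \<bar>b u - b v\<bar> \<le> M * \<bar>u - v\<bar>"
    using b_lipschitz[OF R0] by blast
  define L where "L = 2 * ((M + 1) / \<epsilon>\<^sup>2)"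
  have lip: "norm (f t u - f t v) \<le> L * norm (u - v)" if t: "t \<in> I" for t u v
  proof -
    obtain r x where u: "u = (r, x)" by (cases u)
    obtain r' x' where v: "v = (r', x')" by (cases v)
    have half_sin_le: "\<bar>sin t / 2\<bar> \<le> 1" using abs_sin_le_one[of t] unfolding abs_divide by linarith
    have "\<bar>k t r x - k t r' x'\<bar> = \<bar>(b (cl r) - b (cl r')) * cos t + (max x (l t) - max x' (l t)) * (sin t / 2)\<bar>"
      by (simp add: k_def algebra_simps diff_divide_distrib)
    also have "\<dots> \<le> \<bar>b (cl r) - b (cl r')\<bar> * \<bar>cos t\<bar> + \<bar>max x (l t) - max x' (l t)\<bar> * \<bar>sin t / 2\<bar>"
      by (rule order_trans[OF abs_triangle_ineq]) (simp add: abs_mult)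
    also have "\<dots> \<le> (M * \<bar>cl r - cl r'\<bar>) * 1 + \<bar>x - x'\<bar> * 1"
      using M(2)[OF cl cl] M(1) half_sin_le by (intro add_mono mult_mono) auto
    also have "\<dots> \<le> M * norm (u - v) + norm (u - v)"
      using norm_fst_le[of "r - r'" "x - x'"] norm_snd_le[of "x - x'" "r - r'"] M(1) cl_lip[of r r']
      by (auto simp: u v intro!: add_mono mult_left_mono)
    finally have k_diff: "\<bar>k t r x - k t r' x'\<bar> \<le> (M + 1) * norm (u - v)" by (simp add: algebra_simps)
    have comp: "\<bar>c / k t r x - c / k t r' x'\<bar> \<le> (M + 1) / \<epsilon>\<^sup>2 * norm (u - v)" if "\<bar>c\<bar> \<le> 1" for c
    proof -
      have "\<bar>c / k t r x - c / k t r' x'\<bar> \<le> \<bar>k t r x - k t r' x'\<bar> / \<epsilon>\<^sup>2"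
        by (rule reciprocal_lipschitz) (use eps t that in auto)
      also have "\<dots> \<le> ((M + 1) * norm (u - v)) / \<epsilon>\<^sup>2" by (intro divide_right_mono k_diff) simp
      finally show ?thesis by simp
    qed
    have "f t u - f t v = (sin t / k t r x - sin t / k t r' x', cos t / k t r x - cos t / k t r' x')"
      by (simp add: f_def u v)
    then have "norm (f t u - f t v) \<le> 2 * ((M + 1) / \<epsilon>\<^sup>2 * norm (u - v))"
      by (simp only:) (intro norm_Pair_le_of_components comp; simp)
    then show ?thesis by (simp only: L_def mult.assoc)
  qed
  have f_cont: "continuous_on I (\<lambda>t. f t (v t))" if v: "continuous_on I v" for v
  proof -
    have "continuous_on I (\<lambda>t. b (cl (fst (v t))))"
      by (rule continuous_on_compose2[OF continuous_on_subset[OF b_cont sub]])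
        (use cl in \<open>auto simp: cl_def intro!: continuous_intros v\<close>)
    then have "continuous_on I (\<lambda>t. k t (fst (v t)) (snd (v t)))"
      unfolding k_def l_def using bR0 by (intro continuous_intros v) auto
    then show ?thesis unfolding f_def case_prod_beta using less_imp_neq[OF k_pos]
      by (intro continuous_intros) force+
  qed
  have "\<exists>u. u t0 = (R, 0) \<and> (\<forall>t\<in>I. (u has_vector_derivative f t (u t)) (at t within I))" for R
  proof -
    obtain u where "u t0 = (R, 0)"
      "\<And>t. t \<in> {t0..pi/2} \<Longrightarrow> (u has_vector_derivative f t (u t)) (at t within {t0..pi/2})"
      by (rule lipschitz_ivp_solution[of t0 "pi/2" f L "(R, 0)"])
        (use t0 f_cont[unfolded I_def] lip[unfolded I_def] in auto)
    then show ?thesis unfolding I_def by blast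
  qed
  then obtain U where U: "\<And>R. U R t0 = (R, 0)"
    "\<And>R t. t \<in> I \<Longrightarrow> (U R has_vector_derivative f t (U R t)) (at t within I)"
    by metis
  define r x where "r R t = fst (U R t)" and "x R t = snd (U R t)" for R t
  have rx0: "r R t0 = R" "x R t0 = 0" for R by (simp_all add: r_def x_def U)
  have U_cont: "continuous_on I (U R)" for R
    using U(2) by (auto intro!: has_vector_derivative_continuous simp: continuous_on_eq_continuous_within)
  have r_deriv: "(r R has_real_derivative sin t / k t (r R t) (x R t)) (at t within I)"
    and x_deriv: "(x R has_real_derivative cos t / k t (r R t) (x R t)) (at t within I)"
    if t: "t \<in> I" for R t
    using bounded_linear.has_vector_derivative[OF bounded_linear_fst U(2)[OF t]]
      bounded_linear.has_vector_derivative[OF bounded_linear_snd U(2)[OF t]]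
    unfolding r_def x_def by (auto simp: f_def case_prod_beta has_real_derivative_iff_has_vector_derivative)
  have r_cont: "continuous_on I (r R)" and x_cont: "continuous_on I (x R)" for R
    unfolding r_def x_def by (intro continuous_intros U_cont)+
  have at_I: "at t within I = at t" if "t \<in> {t0<..<pi/2}" for t
    using that by (simp add: I_def at_within_Icc_at)
  have r_mono: "r R u < r R v" if "t0 \<le> u" "u < v" "v \<le> pi/2" for R u v
  proof (rule DERIV_pos_imp_increasing_open[of u v "r R"])
    show "continuous_on {u..v} (r R)" by (rule continuous_on_subset[OF r_cont]) (use that in \<open>auto simp: I_def\<close>)
    fix t assume t: "u < t" "t < v"
    then have tI: "t \<in> I" "t \<in> {t0<..<pi/2}" using that by (auto simp: I_def)
    have "0 < sin t" using tI t0 by (intro sin_gt_zero) auto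
    then show "\<exists>y. (r R has_real_derivative y) (at t) \<and> 0 < y"
      using r_deriv[OF tI(1), of R] k_pos[OF tI(1)] at_I[OF tI(2)] by (metis divide_pos_pos)
  qed (use that in auto)
  have x_ge: "l t \<le> x R t" if t: "t \<in> I" for R t
  proof -
    have "0 \<le> x R t - l t"
    proof (rule nonneg_if_deriv_nonneg_where_neg[of t0 t "\<lambda>t. x R t - l t"])
      have "continuous_on I (\<lambda>t. x R t - l t)" unfolding l_def using bR0
        by (intro continuous_intros x_cont) auto
      then show "continuous_on {t0..t} (\<lambda>t. x R t - l t)"
        by (rule continuous_on_subset) (use t in \<open>auto simp: I_def\<close>)
      show "0 \<le> x R t0 - l t0" by (simp add: rx0 l0)
      show "t0 \<le> t" using t by (simp add: I_def)
      fix u assume u: "u \<in> {t0<..<t}" and neg: "x R u - l u < 0"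
      then have uI: "u \<in> I" "u \<in> {t0<..<pi/2}" using t by (auto simp: I_def)
      have "(l has_real_derivative cos u / (b R0 + 1)) (at u)"
        unfolding l_def using bR0 by (auto intro!: derivative_eq_intros)
      then have "((\<lambda>t. x R t - l t) has_real_derivative
          cos u / k u (r R u) (x R u) - cos u / (b R0 + 1)) (at u)"
        using x_deriv[OF uI(1), of R] unfolding at_I[OF uI(2)] by (intro DERIV_diff)
      moreover have "k u (r R u) (x R u) \<le> b R0 + 1"
      proof -
        have half: "sin u / 2 \<le> 1" using sin_le_one[of u] by linarith
        have "k u (r R u) (x R u) = b (cl (r R u)) * cos u + l u * (sin u / 2)"
          using neg by (simp add: k_def max_def)
        also have "\<dots> \<le> b R0 * 1 + 1 * 1"
          using cl[of "r R u"] sub sin_nonneg[OF uI(1)] bR0 l_le[OF uI(1)] l_nonneg[OF uI(1)] half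
          by (intro add_mono mult_mono b_decreasing R0) auto
        finally show ?thesis by simp
      qed
      then have "cos u / (b R0 + 1) \<le> cos u / k u (r R u) (x R u)"
        using sin_nonneg[OF uI(1)] k_pos[OF uI(1)] bR0 by (intro divide_left_mono mult_pos_pos) auto
      then have "0 \<le> cos u / k u (r R u) (x R u) - cos u / (b R0 + 1)" by simp
      ultimately show "\<exists>y\<ge>0. ((\<lambda>t. x R t - l t) has_real_derivative y) (at u)" by blast
    qed
    then show ?thesis by simp
  qed
  \<comment> \<open>The lower clips are never active: \<open>r\<close> increases from
    \<open>R \<ge> R0\<close>, and \<open>x\<close> stays above the barrier. Thus the truncated
    solution is genuine as long as \<open>r\<close> has not passed \<open>e\<close>.\<close>
  have k_eq: "k t (r R t) (x R t) = curv t (r R t) (x R t)"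
    if "R \<in> {R0..e}" "t \<in> I" "r R t \<le> e" for R t
  proof -
    have "R \<le> r R t" using r_mono[of t0 t R] that rx0[of R] by (cases "t = t0") (auto simp: I_def)
    then have "cl (r R t) = r R t" using that by (intro cl_id) auto
    moreover have "max (x R t) (l t) = x R t" using x_ge[OF that(2), of R] by simp
    ultimately show ?thesis by (simp add: k_def curv_def)
  qed
  have solution: "angle_solution t0 t1 R (r R) (x R)"
    if R: "R \<in> {R0..e}" and t1: "t1 \<in> I" "r R t1 \<le> e" for R t1
  proof -
    have le: "r R t \<le> e" if "t \<in> {t0..t1}" for t
      using r_mono[of t t1 R] that t1 by (cases "t = t1") (auto simp: I_def)
    have ge: "R \<le> r R t" if "t \<in> {t0..t1}" for t
      using r_mono[of t0 t R] that t1 rx0[of R] by (cases "t = t0") (auto simp: I_def)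
    have subI: "{t0..t1} \<subseteq> I" using t1 by (auto simp: I_def)
    show ?thesis unfolding angle_solution_def
    proof (intro conjI ballI rx0)
      show "continuous_on {t0..t1} (r R)" "continuous_on {t0..t1} (x R)"
        by (rule continuous_on_subset[OF r_cont subI] continuous_on_subset[OF x_cont subI])+
      show "r R t \<in> D" if "t \<in> {t0..t1}" for t using le[OF that] ge[OF that] R sub by auto
      show "0 < x R t" if "t \<in> {t0<..t1}" for t
        using l_pos[of t] x_ge[of t R] that t1 by (auto simp: I_def)
      fix t assume t: "t \<in> {t0<..<t1}"
      then have tI: "t \<in> I" "t \<in> {t0<..<pi/2}" "r R t \<le> e" using t1 le[of t] by (auto simp: I_def)
      show "(r R has_real_derivative sin t / curv t (r R t) (x R t)) (at t)"
        "(x R has_real_derivative cos t / curv t (r R t) (x R t)) (at t)"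
        using r_deriv[OF tI(1), of R] x_deriv[OF tI(1), of R] k_eq[OF R tI(1,3)] at_I[OF tI(2)] by simp_all
    qed
  qed
  have pI: "pi/2 \<in> I" "t0 \<in> I" using t0 by (auto simp: I_def)
  show ?thesis
  \<comment> \<open>The final radius of the truncated solution is defined for every
    \<open>R\<close>. A value beyond \<open>e\<close> is not the radius of an actual horizontal
    point known so far; it is there to make the intermediate value theorem applicable.\<close>
  proof (rule that[of "\<lambda>R. r R (pi/2)"])
    have "(exp (L * (pi/2 - t0)))-lipschitz_on {R0..e} (\<lambda>R. r R (pi/2))"
    proof (rule lipschitz_onI)
      fix R R'
      have "norm (U R (pi/2) - U R' (pi/2)) \<le> exp (L * (pi/2 - t0)) * norm (U R t0 - U R' t0)"
      proof (rule gronwall_norm[of t0 "pi/2" "\<lambda>t. U R t - U R' t" "\<lambda>t. f t (U R t) - f t (U R' t)"])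
        show "continuous_on {t0..pi/2} (\<lambda>t. U R t - U R' t)"
          using U_cont unfolding I_def by (intro continuous_intros)
        fix t assume t: "t \<in> {t0<..<pi/2}"
        then have tI: "t \<in> I" by (auto simp: I_def)
        show "((\<lambda>t. U R t - U R' t) has_vector_derivative f t (U R t) - f t (U R' t)) (at t)"
          using U(2)[OF tI, of R] U(2)[OF tI, of R'] unfolding at_I[OF t]
          by (intro has_vector_derivative_diff)
        show "norm (f t (U R t) - f t (U R' t)) \<le> L * norm (U R t - U R' t)" by (rule lip[OF tI])
      qed (use t0 in auto)
      moreover have "norm (U R t0 - U R' t0) = \<bar>R - R'\<bar>" by (simp add: U norm_Pair)
      moreover have "\<bar>r R (pi/2) - r R' (pi/2)\<bar> \<le> norm (U R (pi/2) - U R' (pi/2))"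
        unfolding r_def using norm_fst_le[of "fst (U R (pi/2) - U R' (pi/2))" "snd (U R (pi/2) - U R' (pi/2))"]
        unfolding prod.collapse by (simp only: fst_diff real_norm_def)
      ultimately show "dist (r R (pi/2)) (r R' (pi/2)) \<le> exp (L * (pi/2 - t0)) * dist R R'"
        by (simp add: dist_real_def)
    qed simp
    then show "continuous_on {R0..e} (\<lambda>R. r R (pi/2))" by (rule lipschitz_on_continuous_on)
    fix R assume R: "R \<in> {R0..e}"
    show "R < r R (pi/2)" using r_mono[of t0 "pi/2" R] t0 rx0 by simp
    assume le: "r R (pi/2) \<le> e"
    have "strong_angle_solution t0 R (r R) (x R)"
      unfolding strong_angle_solution_def
    proof (intro conjI ballI)
      show "angle_solution t0 (pi/2) R (r R) (x R)" by (rule solution[OF R pI(1) le])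
      fix t assume "t \<in> {t0..pi/2}"
      then have tI: "t \<in> I" by (simp add: I_def)
      have "r R t \<le> r R (pi/2)"
      proof (cases "t = pi/2")
        case False
        then show ?thesis using r_mono[of t "pi/2" R] tI by (simp add: I_def)
      next
        case True
        show ?thesis unfolding True ..
      qed
      then have "r R t \<le> e" using le by simp
      note k = k_eq[OF R tI this]
      show "(r R has_real_derivative sin t / curv t (r R t) (x R t)) (at t within {t0..pi/2})"
        "(x R has_real_derivative cos t / curv t (r R t) (x R t)) (at t within {t0..pi/2})"
        using r_deriv[OF tI, of R] x_deriv[OF tI, of R] k by (simp_all add: I_def)
    qed
    then show "\<exists>r' x'. strong_angle_solution t0 R r' x' \<and> r' (pi/2) = r R (pi/2)" by blast
  next
    assume "e < r R0 (pi/2)"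
    moreover have "R0 \<le> e" by (rule le_e[OF R0])
    ultimately obtain t1 where t1: "t0 \<le> t1" "t1 \<le> pi/2" "r R0 t1 = e"
      using IVT'[of "r R0" t0 e "pi/2"] rx0[of R0] r_cont[of R0] t0 unfolding I_def by auto
    then have "angle_solution t0 t1 R0 (r R0) (x R0)"
      using \<open>R0 \<le> e\<close> by (intro solution) (auto simp: I_def)
    moreover have "\<forall>t\<in>{t0..t1}. (sin t - sin t0) / (b R0 + 1) \<le> x R0 t"
      using x_ge[of _ R0] t1 by (auto simp: I_def l_def)
    ultimately show "\<exists>t1 r x. t0 \<le> t1 \<and> t1 \<le> pi/2 \<and> angle_solution t0 t1 R0 r x \<and> r t1 = e \<and>
        (\<forall>t\<in>{t0..t1}. (sin t - sin t0) / (b R0 + 1) \<le> x t)" using t1 by blast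
  qed
qed

text \<open>Far from \<open>e\<close> a solution becomes horizontal before reaching \<open>e\<close>: up to \<open>cos t = c1\<close>
  the radius is controlled because \<open>F r * cos t\<close> decreases, and afterwards because \<open>r' \<le> 2 / x\<close>.\<close>
lemma solutions_staying_below:
  assumes t0: "0 \<le> t0" "t0 < pi/2" and "r' \<in> D"
  obtains R0 where "R0 \<in> D" "R0 < r'" "\<And>t1 r x. t1 \<le> pi/2 \<Longrightarrow> t0 \<le> t1 \<Longrightarrow> angle_solution t0 t1 R0 r x \<Longrightarrow>
     (\<forall>t\<in>{t0..t1}. (sin t - sin t0) / (b R0 + 1) \<le> x t) \<Longrightarrow> r t1 \<noteq> e"
proof -
  obtain m where m: "m \<in> D" "m < e" using F_small[OF e_in, of 1] by auto
  define s0 c0 where "s0 = sin t0" and "c0 = cos t0"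
  have "0 \<le> s0" unfolding s0_def using t0 by (intro sin_ge_zero) auto
  have "0 < c0" unfolding c0_def using t0 by (intro cos_gt_zero_pi) auto
  have "s0 < 1" unfolding s0_def using sin_monotone_2pi[of t0 "pi/2"] t0 pi_gt_zero by simp
  \<comment> \<open>The first bound gives \<open>sin T - s0 \<ge> (1 - s0) / 2\<close>, the second
    puts \<open>T\<close> after \<open>t0\<close>, and the third limits the final advance of the
    radius to \<open>(e - m) / 2\<close>, that is, to \<open>8 * \<delta> / (1 - s0)\<close> at
    most.\<close>
  define \<delta> where "\<delta> = min (min ((1 - s0) / 2) (c0 / 2)) ((e - m) * (1 - s0) / 16)"
  have "\<delta> \<le> (1 - s0) / 2 \<and> \<delta> \<le> c0 / 2 \<and> \<delta> \<le> (e - m) * (1 - s0) / 16"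
  proof -
    have "min (min a b) c \<le> a \<and> min (min a b) c \<le> b \<and> min (min a b) c \<le> c" for a b c :: real
      by (simp add: min.coboundedI1)
    then show ?thesis unfolding \<delta>_def .
  qed
  moreover have "0 < \<delta>" using \<open>s0 < 1\<close> \<open>0 < c0\<close> m unfolding \<delta>_def by simp
  ultimately have \<delta>: "0 < \<delta>" "\<delta> \<le> (1 - s0) / 2" "\<delta> < c0" "\<delta> \<le> (e - m) * (1 - s0) / 16"
    using \<open>0 < c0\<close> by linarith+
  have "0 < \<delta> * F m" using \<delta> F_pos[OF m(1)] by simp
  moreover have "min r' m \<in> D" using \<open>r' \<in> D\<close> m by (simp add: min_def)
  ultimately obtain R0 where R0: "R0 \<in> D" "R0 < min r' m" "F R0 * (b R0 + 1) < \<delta> * F m"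
    using F_small by blast
  define B where "B = b R0 + 1"
  have B: "1 \<le> B" using b_pos[OF R0(1)] by (simp add: B_def)
  \<comment> \<open>Two effects of \<open>B\<close> are balanced. Up to \<open>cos t = c1\<close>
    the bound \<open>F r * c1 \<le> F R0\<close> keeps \<open>r\<close> below \<open>m\<close>,
    because \<open>F R0 * B < \<delta> * F m\<close>. Afterwards an angle of at most
    \<open>2 * c1\<close> remains, while \<open>r'\<close> is bounded by a multiple of
    \<open>B\<close>; in the product \<open>B\<close> cancels. This is why \<open>F_small\<close>
    contains the factor \<open>b R + 1\<close>.\<close>
  define c1 where "c1 = \<delta> / B"
  have c1: "0 < c1" "c1 \<le> \<delta>" using \<delta>(1) B by (auto simp: c1_def field_simps)
  define T where "T = arccos c1"
  have c1_le: "c1 < 1" using c1 \<delta> \<open>0 \<le> s0\<close> by simp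
  have cosT: "cos T = c1" unfolding T_def using c1 c1_le by (intro cos_arccos) auto
  have T_bounds: "0 \<le> T" "T < pi/2" unfolding T_def using c1 c1_le arccos_lt_bounded[of c1]
      arccos_less_mono[of c1 0] by (auto intro!: arccos_lbound)
  have t0T: "t0 < T"
  proof (rule ccontr)
    assume "\<not> t0 < T"
    then have "cos t0 \<le> cos T" using t0 T_bounds by (intro cos_monotone_0_pi_le) auto
    then show False using cosT c1 \<delta>(3) by (simp add: c0_def)
  qed
  have sinT: "1 - c1 \<le> sin T"
  proof (rule power2_le_imp_le)
    have "(sin T)\<^sup>2 = 1 - c1\<^sup>2" using sin_squared_eq[of T] cosT by simp
    moreover have "(1 - c1)\<^sup>2 \<le> 1 - c1\<^sup>2"
    proof -
      have "0 \<le> 2 * c1 * (1 - c1)" using c1 c1_le by simp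
      then show ?thesis by (simp add: power2_eq_square algebra_simps)
    qed
    ultimately show "(1 - c1)\<^sup>2 \<le> (sin T)\<^sup>2" by simp
    show "0 \<le> sin T" using T_bounds by (intro sin_ge_zero) auto
  qed
  have sinT': "(1 - s0) / 2 \<le> sin T - s0" "1 / 2 \<le> sin T"
    using sinT c1 \<delta>(2) \<open>0 \<le> s0\<close> by (auto simp: field_simps)
  have T_len: "pi/2 - T \<le> 2 * c1"
  proof -
    have "\<exists>z>T. z < pi/2 \<and> cos (pi/2) - cos T = (pi/2 - T) * (- sin z)"
      by (rule MVT2) (use T_bounds in \<open>auto intro!: derivative_eq_intros\<close>)
    then obtain z where z: "T < z" "z < pi/2" "c1 = (pi/2 - T) * sin z" by (auto simp: cosT)
    have "sin T \<le> sin z" using z T_bounds by (intro sin_monotone_2pi_le) auto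
    then have "(pi/2 - T) * (1 / 2) \<le> (pi/2 - T) * sin z" using sinT' T_bounds by (intro mult_left_mono) auto
    then show ?thesis using z(3) by simp
  qed
  show ?thesis
  proof (rule that[OF R0(1)])
    show "R0 < r'" using R0(2) by simp
    fix t1 r x
    assume t1: "t1 \<le> pi/2" "t0 \<le> t1" and sol: "angle_solution t0 t1 R0 r x"
      and x_ge: "\<forall>t\<in>{t0..t1}. (sin t - sin t0) / (b R0 + 1) \<le> x t"
    note s = angle_solutionD[OF sol]
    have k_pos: "0 < curv t (r t) (x t)" if "t \<in> {t0..t1}" for t
      by (rule angle_solution_curv_pos[OF sol t0 t1(1) that])
    have before: "r t < m" if t: "t \<in> {t0..t1}" "t \<le> T" for t
    proof -
      have "F (r t) * cos t \<le> F (r t0) * cos t0"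
      proof (rule DERIV_nonpos_imp_decreasing_open[of t0 t "\<lambda>t. F (r t) * cos t"])
        have "continuous_on {t0..t1} (\<lambda>t. F (r t) * cos t)"
          by (intro continuous_intros angle_solution_F_cont[OF sol])
        then show "continuous_on {t0..t} (\<lambda>t. F (r t) * cos t)"
          by (rule continuous_on_subset) (use t in auto)
        fix u assume "t0 < u" "u < t"
        then have u: "u \<in> {t0<..<t1}" "u \<in> {t0..t1}" "u \<le> pi/2" using t t1 by auto
        define \<kappa> where "\<kappa> = curv u (r u) (x u)"
        have "((\<lambda>t. F (r t) * cos t) has_real_derivative
            b (r u) * F (r u) * (sin u / \<kappa>) * cos u + - sin u * F (r u)) (at u)"
          unfolding \<kappa>_def
          by (intro DERIV_mult DERIV_chain2[OF F_deriv[OF s(5)[OF u(2)]] s(8)[OF u(1)]] DERIV_cos)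
        moreover have "b (r u) * F (r u) * (sin u / \<kappa>) * cos u + - sin u * F (r u) \<le> 0"
        proof -
          have sp: "0 \<le> sin u" using u t0 t1 by (intro sin_ge_zero) auto
          have "b (r u) * cos u \<le> \<kappa>" using s(7)[OF u(2)] sp by (simp add: \<kappa>_def curv_def)
          then have "(b (r u) * cos u) / \<kappa> \<le> 1" using k_pos[OF u(2)] by (simp add: \<kappa>_def)
          then have "(F (r u) * sin u) * ((b (r u) * cos u) / \<kappa>) \<le> (F (r u) * sin u) * 1"
            using sp F_pos[OF s(5)[OF u(2)]] by (intro mult_left_mono) auto
          then show ?thesis by (simp add: algebra_simps)
        qed
        ultimately show "\<exists>y. ((\<lambda>t. F (r t) * cos t) has_real_derivative y) (at u) \<and> y \<le> 0" by blast
      qed (use t in auto)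
      moreover have "c1 \<le> cos t"
        using cos_monotone_0_pi_le[of t T] t t0 T_bounds cosT by auto
      then have "F (r t) * c1 \<le> F (r t) * cos t"
        using F_pos[OF s(5)[OF t(1)]] by (intro mult_left_mono) auto
      moreover have "F (r t0) * cos t0 \<le> F R0 * 1"
        using F_pos[OF R0(1)] by (simp add: s(3) mult_left_le)
      ultimately have "F (r t) * c1 \<le> F R0" by simp
      then have "F (r t) * \<delta> \<le> F R0 * B" using B by (simp add: c1_def field_simps)
      also have "\<dots> < F m * \<delta>" using R0(3) by (simp add: B_def mult.commute)
      finally have "F (r t) < F m" using \<delta>(1) by simp
      then show ?thesis
        using F_strict_increasing[OF m(1) s(5)[OF t(1)]] by (cases "r t" m rule: linorder_cases) auto
    qed
    show "r t1 \<noteq> e"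
    proof
      assume e: "r t1 = e"
      have "T < t1" using before[of t1] t1 e m by force
      define X where "X = (sin T - s0) / B"
      have X: "0 < X" using sinT' \<open>s0 < 1\<close> B by (simp add: X_def)
      have "r t1 - 2 / X * t1 \<le> r T - 2 / X * T"
      proof (rule DERIV_nonpos_imp_decreasing_open[of T t1 "\<lambda>t. r t - 2 / X * t"])
        have "continuous_on {t0..t1} (\<lambda>t. r t - 2 / X * t)" by (intro continuous_intros s)
        then show "continuous_on {T..t1} (\<lambda>t. r t - 2 / X * t)"
          by (rule continuous_on_subset) (use t0T in auto)
        fix u assume u: "T < u" "u < t1"
        then have uI: "u \<in> {t0<..<t1}" "u \<in> {t0..t1}" using t0T by auto
        define \<kappa> where "\<kappa> = curv u (r u) (x u)"
        have sp: "0 < sin u" using u t1 T_bounds by (intro sin_gt_zero) auto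
        have cp: "0 \<le> cos u" using u t1 T_bounds by (intro cos_ge_zero) auto
        have "sin T \<le> sin u" using u t1 T_bounds by (intro sin_monotone_2pi_le) auto
        then have "X \<le> (sin u - sin t0) / (b R0 + 1)"
          unfolding X_def s0_def B_def[symmetric] using B by (intro divide_right_mono) auto
        then have "X \<le> x u" using x_ge uI(2) by force
        then have "X * sin u / 2 \<le> x u * sin u / 2" using sp by simp
        also have "\<dots> \<le> \<kappa>" using b_pos[OF s(5)[OF uI(2)]] cp by (simp add: \<kappa>_def curv_def)
        finally have "sin u / \<kappa> \<le> sin u / (X * sin u / 2)"
          using sp X k_pos[OF uI(2)] by (intro divide_left_mono mult_pos_pos) (auto simp: \<kappa>_def)
        also have "\<dots> = 2 / X" using sp X by simp
        finally have "sin u / \<kappa> - 2 / X \<le> 0" by simp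
        moreover have "((\<lambda>t. r t - 2 / X * t) has_real_derivative sin u / \<kappa> - 2 / X) (at u)"
          unfolding \<kappa>_def using X by (auto intro!: derivative_eq_intros s(8)[OF uI(1)])
        ultimately show "\<exists>y. ((\<lambda>t. r t - 2 / X * t) has_real_derivative y) (at u) \<and> y \<le> 0" by blast
      qed (use \<open>T < t1\<close> in auto)
      then have "e - r T \<le> 2 / X * (t1 - T)" using e unfolding right_diff_distrib by linarith
      also have "\<dots> \<le> 2 / X * (2 * c1)" using T_len t1 X by (intro mult_left_mono) auto
      also have "\<dots> = 4 * \<delta> / (sin T - s0)" using B by (simp add: X_def c1_def field_simps)
      also have "\<dots> \<le> 4 * \<delta> / ((1 - s0) / 2)"
        using sinT' \<open>s0 < 1\<close> \<delta>(1) by (intro divide_left_mono mult_pos_pos) auto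
      also have "\<dots> \<le> (e - m) / 2" using \<delta>(4) \<open>s0 < 1\<close> by (simp add: field_simps)
      finally have "e - r T \<le> (e - m) / 2" .
      moreover have "r T < m" using before[of T] t0T \<open>T < t1\<close> by auto
      ultimately show False using m by simp
    qed
  qed
qed

end

section \<open>Horizontal points\<close>

context shrinker_profile begin

lemma horizontal_point_angle_solution:
  assumes C: "0 < C" and "R \<in> D" and hp: "horizontal_point n C R (\<rho>, h)" and "\<rho> \<le> e"
  obtains r x where "angle_solution (start_angle C) (pi/2) R r x" "r (pi/2) = \<rho>" "x (pi/2) = h"
proof -
  obtain g p where *: "R < \<rho>" "shrinker_ivp n C R \<rho> g p"
    "\<And>r. r \<in> {R<..\<rho>} \<Longrightarrow> 0 \<le> g r" "\<And>r. r \<in> {R<..\<rho>} \<Longrightarrow> 0 \<le> p r" "p \<rho> = 0" "g \<rho> = h"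
    using hp by (auto simp: horizontal_point_def)
  have "\<rho> \<in> D" using upward[OF \<open>R \<in> D\<close>] *(1) \<open>\<rho> \<le> e\<close> by simp
  from ivp_angle_solution[OF *(2) C *(1) \<open>R \<in> D\<close> this *(3,4)] show ?thesis
    using that *(5,6) by auto
qed

lemma horizontal_points_ordered:
  assumes C: "0 < C" and "R1 \<in> D" "R2 \<in> D" "R1 < R2"
    and hp1: "horizontal_point n C R1 (\<rho>1, h1)" "\<rho>1 \<le> e"
    and hp2: "horizontal_point n C R2 (\<rho>2, h2)" "\<rho>2 \<le> e"
  shows "\<rho>1 < \<rho>2" "h1 < h2"
proof -
  note t0 = start_angle_bounds[OF C]
  obtain r1 x1 where 1: "angle_solution (start_angle C) (pi/2) R1 r1 x1" "r1 (pi/2) = \<rho>1" "x1 (pi/2) = h1"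
    using horizontal_point_angle_solution[OF C \<open>R1 \<in> D\<close> hp1] by blast
  obtain r2 x2 where 2: "angle_solution (start_angle C) (pi/2) R2 r2 x2" "r2 (pi/2) = \<rho>2" "x2 (pi/2) = h2"
    using horizontal_point_angle_solution[OF C \<open>R2 \<in> D\<close> hp2] by blast
  note r = radii_ordered[OF t0 1(1) 2(1) \<open>R1 < R2\<close>]
  show "\<rho>1 < \<rho>2" using r[of "pi/2"] t0 1(2) 2(2) by simp
  show "h1 < h2" using heights_ordered[OF t0 1(1) 2(1), of "pi/2"] r t0 1(3) 2(3) by simp
qed

text \<open>If both points are at most \<open>e\<close>, this is uniqueness in the angle variable. A
  graph continuing beyond \<open>e\<close> is cut there: by uniqueness it meets \<open>e\<close>
  with angle \<open>pi/2\<close>, since the other solution would otherwise end beyond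
  \<open>e\<close>. Its slope is thus \<open>0\<close> at \<open>e\<close> with negative derivative,
  and becomes negative right after \<open>e\<close>, which is excluded.\<close>

lemma horizontal_point_unique:
  assumes C: "0 < C" and "R \<in> D"
    and hp: "horizontal_point n C R (\<rho>, h)" "\<rho> \<le> e" and hp': "horizontal_point n C R (\<rho>', h')"
  shows "\<rho>' = \<rho> \<and> h' = h"
proof -
  note t0 = start_angle_bounds[OF C]
  obtain r x where sol: "angle_solution (start_angle C) (pi/2) R r x" "r (pi/2) = \<rho>" "x (pi/2) = h"
    using horizontal_point_angle_solution[OF C \<open>R \<in> D\<close> hp] by blast
  show ?thesis
  proof (cases "\<rho>' \<le> e")
    case True
    obtain r' x' where sol': "angle_solution (start_angle C) (pi/2) R r' x'" "r' (pi/2) = \<rho>'" "x' (pi/2) = h'"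
      using horizontal_point_angle_solution[OF C \<open>R \<in> D\<close> hp' True] by blast
    then show ?thesis
      using angle_solution_unique[OF t0 _ order_refl sol(1) sol'(1)] t0 sol by simp
  next
    case False
    obtain g p where *: "R < \<rho>'" "shrinker_ivp n C R \<rho>' g p"
      "\<And>r. r \<in> {R<..\<rho>'} \<Longrightarrow> 0 \<le> g r" "\<And>r. r \<in> {R<..\<rho>'} \<Longrightarrow> 0 \<le> p r"
      using hp' by (auto simp: horizontal_point_def)
    have "R < e" using hp by (auto simp: horizontal_point_def)
    define t1 where "t1 = pi/2 - arctan (p e)"
    have ivp_e: "shrinker_ivp n C R e g p"
      by (rule shrinker_ivp_restrict[OF *(2) \<open>R < e\<close>]) (use False in simp)
    obtain r' x' where sol': "angle_solution (start_angle C) t1 R r' x'" "r' t1 = e" "x' t1 = g e"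
      "start_angle C < t1"
      unfolding t1_def
      using ivp_angle_solution[OF ivp_e C \<open>R < e\<close> \<open>R \<in> D\<close> e_in] *(3,4) False by auto
    have t1: "t1 \<le> pi/2" using *(4)[of e] False \<open>R < e\<close> by (simp add: t1_def)
    have "r t1 = r' t1 \<and> x t1 = x' t1"
      using angle_solution_unique[OF t0 _ t1 angle_solution_restrict[OF sol(1) t1] sol'(1)] sol'(4) by simp
    then have eq: "r t1 = e" "x t1 = g e" using sol' by auto
    have "t1 = pi/2"
    proof (rule ccontr)
      assume "t1 \<noteq> pi/2"
      then have "r t1 < r (pi/2)"
        using t1 sol'(4) by (intro angle_solution_strict_increasing[OF sol(1) t0 order_refl]) auto
      then show False using eq sol hp(2) by simp
    qed
    then have "p e = 0" by (simp add: t1_def)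
    have "0 < x t1" by (rule angle_solutionD(6)[OF sol(1)]) (use sol'(4) t1 in auto)
    then have "0 < g e" using eq by simp
    have "e \<in> {R<..\<rho>'}" using False \<open>R < e\<close> by simp
    then obtain q where q: "(p has_real_derivative q) (at e within {R<..\<rho>'})"
      "q / (1 + (p e)\<^sup>2) = (e / 2 - (real n - 1) / e) * p e - g e / 2"
      using shrinker_ivp_cases(1)[OF *(2) C *(1)] unfolding shrinker_solution_on_def by blast
    then have "q < 0" using \<open>p e = 0\<close> \<open>0 < g e\<close> by simp
    from has_real_derivative_neg_dec_right[OF q(1) this] obtain d where
      d: "d > 0" "\<And>s. 0 < s \<Longrightarrow> e + s \<in> {R<..\<rho>'} \<Longrightarrow> s < d \<Longrightarrow> p (e + s) < p e" by blast
    define s where "s = min (d / 2) (\<rho>' - e)"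
    have s: "0 < s" "s < d" "e + s \<in> {R<..\<rho>'}" using d(1) False \<open>R < e\<close> by (auto simp: s_def)
    have "p (e + s) < 0" using d(2)[OF s(1,3,2)] \<open>p e = 0\<close> by simp
    then show ?thesis using *(4)[OF s(3)] by simp
  qed
qed

lemma horizontal_point_if_strong_angle_solution:
  assumes "0 < C" "strong_angle_solution (start_angle C) R r x"
  shows "horizontal_point n C R (r (pi/2), x (pi/2))"
  using assms unfolding strong_angle_solution_def
  by (intro angle_solution_horizontal_point) auto

text \<open>The final radius depends continuously on the starting point, is at most \<open>e\<close>
  for a start far to the left, and exceeds \<open>e\<close> for a start at \<open>e\<close>. The
  last claim prepares the neighbourhood needed for monotonicity.\<close>

lemma horizontal_point_on_line:
  assumes C: "0 < C"
  obtains R h where "R \<in> D" "R < e" "horizontal_point n C R (e, h)"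
    "\<And>R'. R' \<in> D \<Longrightarrow> R' < R \<Longrightarrow> \<exists>\<rho> h'. \<rho> < e \<and> horizontal_point n C R' (\<rho>, h')"
proof -
  note t0 = start_angle_bounds[OF C]
  have early: "\<exists>R0\<in>D. R0 < r' \<and> (\<exists>\<rho>. continuous_on {R0..e} \<rho> \<and> (\<forall>R\<in>{R0..e}. R < \<rho> R) \<and> \<rho> R0 \<le> e \<and>
      (\<forall>R\<in>{R0..e}. \<rho> R \<le> e \<longrightarrow> (\<exists>h. horizontal_point n C R (\<rho> R, h))))" if r': "r' \<in> D" for r'
  proof -
    obtain R0 where R0: "R0 \<in> D" "R0 < r'" "\<And>t1 r x. t1 \<le> pi/2 \<Longrightarrow> start_angle C \<le> t1 \<Longrightarrow>
        angle_solution (start_angle C) t1 R0 r x \<Longrightarrow>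
        (\<forall>t\<in>{start_angle C..t1}. (sin t - sin (start_angle C)) / (b R0 + 1) \<le> x t) \<Longrightarrow> r t1 \<noteq> e"
      using solutions_staying_below[OF t0 r'] by blast
    obtain \<rho> where \<rho>: "continuous_on {R0..e} \<rho>" "\<And>R. R \<in> {R0..e} \<Longrightarrow> R < \<rho> R"
      "\<And>R. R \<in> {R0..e} \<Longrightarrow> \<rho> R \<le> e \<Longrightarrow>
         \<exists>r x. strong_angle_solution (start_angle C) R r x \<and> r (pi/2) = \<rho> R"
      "e < \<rho> R0 \<Longrightarrow> \<exists>t1 r x. start_angle C \<le> t1 \<and> t1 \<le> pi/2 \<and> angle_solution (start_angle C) t1 R0 r x \<and>
        r t1 = e \<and> (\<forall>t\<in>{start_angle C..t1}. (sin t - sin (start_angle C)) / (b R0 + 1) \<le> x t)"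
      using solution_family[OF t0 R0(1)] by blast
    have "\<rho> R0 \<le> e" using \<rho>(4) R0(3) by (meson not_less)
    moreover have "\<exists>h. horizontal_point n C R (\<rho> R, h)" if R: "R \<in> {R0..e}" "\<rho> R \<le> e" for R
      using \<rho>(3)[OF R] horizontal_point_if_strong_angle_solution[OF C] by metis
    ultimately show ?thesis using R0(1,2) \<rho>(1,2) by blast
  qed
  obtain R0 \<rho> where R0: "R0 \<in> D" "R0 < e" "continuous_on {R0..e} \<rho>" "\<And>R. R \<in> {R0..e} \<Longrightarrow> R < \<rho> R"
    "\<rho> R0 \<le> e" "\<And>R. R \<in> {R0..e} \<Longrightarrow> \<rho> R \<le> e \<Longrightarrow> \<exists>h. horizontal_point n C R (\<rho> R, h)"
    using early[OF e_in] by metis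
  have "e < \<rho> e" using R0 by auto
  then obtain R where R: "R0 \<le> R" "R \<le> e" "\<rho> R = e"
    using IVT'[OF R0(5) less_imp_le[OF \<open>e < \<rho> e\<close>] less_imp_le[OF R0(2)] R0(3)] by blast
  then have "R < e" using \<open>e < \<rho> e\<close> by (cases "R = e") auto
  have RD: "R \<in> D" using between_in_D[OF R0(1) e_in] R by simp
  obtain h where h: "horizontal_point n C R (e, h)" using R0(6)[of R] R by auto
  have "\<exists>\<sigma> h'. \<sigma> < e \<and> horizontal_point n C R' (\<sigma>, h')" if R': "R' \<in> D" "R' < R" for R'
  proof -
    obtain R1 \<rho>1 where R1: "R1 \<in> D" "R1 < R'" "continuous_on {R1..e} \<rho>1"
      "\<rho>1 R1 \<le> e" "\<And>R. R \<in> {R1..e} \<Longrightarrow> \<rho>1 R \<le> e \<Longrightarrow> \<exists>h. horizontal_point n C R (\<rho>1 R, h)"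
      using early[OF R'(1)] by metis
    have "R' \<le> e" using le_e[OF R'(1)] .
    \<comment> \<open>Otherwise the intermediate value theorem on \<open>{R1..R'}\<close> gives a
      start \<open>S < R\<close> whose horizontal point also lies on the line, against the strict
      order of horizontal points.\<close>
    have "\<rho>1 R' \<le> e"
    proof (rule ccontr)
      assume "\<not> \<rho>1 R' \<le> e"
      moreover have "continuous_on {R1..R'} \<rho>1"
        by (rule continuous_on_subset[OF R1(3)]) (use \<open>R' \<le> e\<close> in auto)
      ultimately obtain S where S: "R1 \<le> S" "S \<le> R'" "\<rho>1 S = e"
        using IVT'[of \<rho>1 R1 e R', OF R1(4)] R1(2) by auto
      then obtain k where "horizontal_point n C S (e, k)" using R1(5)[of S] \<open>R' \<le> e\<close> by auto
      moreover have "S \<in> D" using between_in_D[OF R1(1) R'(1)] S by simp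
      ultimately show False
        using horizontal_points_ordered(1)[OF C _ RD _ _ _ h] S R' by force
    qed
    then obtain k where k: "horizontal_point n C R' (\<rho>1 R', k)" using R1(2,5) \<open>R' \<le> e\<close> by force
    moreover have "\<rho>1 R' < e"
      using horizontal_points_ordered(1)[OF C R'(1) RD R'(2) k \<open>\<rho>1 R' \<le> e\<close> h] by simp
    ultimately show ?thesis by blast
  qed
  then show ?thesis using that RD \<open>R < e\<close> h by blast
qed

text \<open>With \<open>RL\<close> the start whose horizontal point is on the line, the ordering
  forces \<open>R < RL\<close>. The part of \<open>D\<close> left of \<open>RL\<close> is then one
  neighbourhood that serves all such \<open>R\<close> at once; removing \<open>e\<close> makes it
  open and loses nothing, as \<open>RL < e\<close>.\<close>

lemma horizontal_curve_monotone_increasing: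
  assumes C: "0 < C" and sub: "D - {e} \<subseteq> S"
    and R: "R \<in> D" "horizontal_point n C R (\<rho>, h)" "\<rho> < e"
  shows "monotone_increasing_at n C S R"
proof -
  obtain RL hL where RL: "RL \<in> D" "RL < e" "horizontal_point n C RL (e, hL)"
    "\<And>R'. R' \<in> D \<Longrightarrow> R' < RL \<Longrightarrow> \<exists>\<rho> h'. \<rho> < e \<and> horizontal_point n C R' (\<rho>, h')"
    using horizontal_point_on_line[OF C] by metis
  have "R < RL"
  proof (rule ccontr)
    assume "\<not> R < RL"
    then consider "R = RL" | "RL < R" by linarith
    then show False
    proof cases
      case 1
      then show False using horizontal_point_unique[OF C R(1) R(2) _ ] RL(3) R(3) by force
    next
      case 2
      then show False using horizontal_points_ordered(1)[OF C RL(1) R(1) _ RL(3) _ R(2)] R(3) by simp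
    qed
  qed
  define I where "I = (D - {e}) \<inter> {..<RL}"
  have I: "R' \<in> I \<longleftrightarrow> R' \<in> D \<and> R' < RL" for R' using RL(2) by (auto simp: I_def)
  \<comment> \<open>Monotonicity speaks about every horizontal point of a start in \<open>I\<close>.
    One of them is left of the line, and uniqueness rules out any further one.\<close>
  have below: "\<rho>' < e" if "R' \<in> I" "horizontal_point n C R' (\<rho>', h')" for R' \<rho>' h'
    using RL(4)[of R'] horizontal_point_unique[OF C, of R'] that I by (metis less_imp_le)
  show ?thesis unfolding monotone_increasing_at_def
  proof (intro exI[of _ I] conjI ballI allI impI)
    show "open I" unfolding I_def by (intro open_Int open_D) simp
    show "is_interval I" unfolding is_interval_1 Ball_def I
      using between_in_D by (meson le_less_trans)
    show "R \<in> I" using I R(1) \<open>R < RL\<close> by simp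
    show "I \<subseteq> S" using sub by (auto simp: I_def)
    show "\<exists>P. horizontal_point n C R' P" if "R' \<in> I" for R' using RL(4) that I by blast
    fix R1 R2 \<rho>1 h1 \<rho>2 h2
    assume *: "R1 \<in> I" "R2 \<in> I" "R1 < R2"
      "horizontal_point n C R1 (\<rho>1, h1)" "horizontal_point n C R2 (\<rho>2, h2)"
    have "R1 \<in> D" "R2 \<in> D" "\<rho>1 \<le> e" "\<rho>2 \<le> e"
      using * I below[OF *(1,4)] below[OF *(2,5)] by auto
    then show "\<rho>1 < \<rho>2" "h1 < h2"
      using horizontal_points_ordered[OF C _ _ *(3) *(4) _ *(5)] by auto
  qed
qed

lemma horizontal_curve_meets_line_once:
  assumes C: "0 < C" and sub: "D - {e} \<subseteq> S" and S: "\<And>R. R \<in> S \<Longrightarrow> R < e \<Longrightarrow> R \<in> D"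
  shows "\<exists>!P. P \<in> horizontal_curve n C S \<and> fst P = e"
proof -
  obtain RL hL where RL: "RL \<in> D" "RL < e" "horizontal_point n C RL (e, hL)"
    using horizontal_point_on_line[OF C] by metis
  show ?thesis
  proof (rule ex1I[of _ "(e, hL)"])
    show "(e, hL) \<in> horizontal_curve n C S \<and> fst (e, hL) = e"
      using RL sub by (auto simp: horizontal_curve_def)
    fix P assume P: "P \<in> horizontal_curve n C S \<and> fst P = e"
    then obtain R h where R: "R \<in> S" "P = (e, h)" "horizontal_point n C R (e, h)"
      by (cases P) (auto simp: horizontal_curve_def)
    \<comment> \<open>Starts to the right of the line are harmless, since a horizontal point lies to
      the right of its start.\<close>
    then have "R < e" by (simp add: horizontal_point_def)
    then have RD: "R \<in> D" using S R by simp
    have "R = RL"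
    proof (rule ccontr)
      assume "R \<noteq> RL"
      then show False
        using horizontal_points_ordered(1)[OF C RD RL(1) _ R(3) _ RL(3)]
          horizontal_points_ordered(1)[OF C RL(1) RD _ RL(3) _ R(3)] by force
    qed
    then show "P = (e, hL)"
      using horizontal_point_unique[OF C RL(1) RL(3) _ , of e h] R by simp
  qed
qed

end

section \<open>The concrete coefficient \<open>b\<close>, its weight, and the two regions\<close>

text \<open>This is the origin of the radicals: with \<open>m = n - 1\<close>, equality
  \<open>A = b\<^sup>2\<close> holds exactly for \<open>r\<^sup>2 = 2 m + 1 + w\<close> or
  \<open>r\<^sup>2 = 2 m + 1 - w\<close>, where \<open>w = sqrt (8 m + 1)\<close>. The larger root
  gives \<open>r_L1\<close>, the smaller one \<open>r_1\<close>, and \<open>A < b\<^sup>2\<close>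
  holds outside the two roots.\<close>

lemma shrinker_slope_identity:
  fixes m r :: real
  assumes "r \<noteq> 0"
  shows "(m / r - r / 2)\<^sup>2 - (1 / 2 + m / r\<^sup>2) = ((r\<^sup>2 - (2 * m + 1))\<^sup>2 - (8 * m + 1)) / (4 * r\<^sup>2)"
  using assms by (simp add: field_simps power2_eq_square)

text \<open>With \<open>s\<close> the sign of \<open>r\<close> the function is
  \<open>|r|^m exp(-r^2/4)\<close>, written so that one computation serves both regions.\<close>

lemma exp_ln_deriv:
  assumes "r \<noteq> 0" "s * r > 0" "s \<noteq> (0::real)"
  shows "((\<lambda>r. exp (m * ln (s * r) - r\<^sup>2 / 4)) has_real_derivative
    (m / r - r / 2) * exp (m * ln (s * r) - r\<^sup>2 / 4)) (at r)"
  using assms by (auto intro!: derivative_eq_intros simp: field_simps)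

lemma shrinker_profile_negative:
  assumes n: "2 \<le> n"
  defines "m \<equiv> real n - 1"
  shows "shrinker_profile (\<lambda>r. m / r - r / 2) (\<lambda>r. 1 / 2 + m / r\<^sup>2)
    (\<lambda>r. exp (m * ln (- 1 * r) - r\<^sup>2 / 4)) {..r_L1 n} (r_L1 n) n"
proof -
  have m: "1 \<le> m" using n by (simp add: m_def)
  define w where "w = sqrt (8 * m + 1)"
  have w: "1 < w" "w\<^sup>2 = 8 * m + 1" using m by (auto simp: w_def)
  have e: "r_L1 n = - sqrt (2 * m + 1 + w)" by (simp add: r_L1_def m_def w_def)
  have e_neg: "r_L1 n < 0" using m w by (simp add: e)
  have e2: "(r_L1 n)\<^sup>2 = 2 * m + 1 + w" using m w by (simp add: e)
  have le: "2 * m + 1 + w \<le> r\<^sup>2" if "r \<le> r_L1 n" for r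
    using power_mono[of "- r_L1 n" "- r" 2] that e_neg e2 by simp
  have less: "2 * m + 1 + w < r\<^sup>2" if "r < r_L1 n" for r
    using power_strict_mono[of "- r_L1 n" "- r" 2] that e_neg e2 by simp
  have small: "\<exists>R\<in>{..r_L1 n}. R < r \<and> exp (m * ln (- 1 * R) - R\<^sup>2 / 4) * ((m / R - R / 2) + 1) < d"
    if "r \<in> {..r_L1 n}" "0 < d" for r d
  proof -
    \<comment> \<open>The start is \<open>- s\<close>. \<open>1 - r\<close> puts it left of
      \<open>r\<close>, \<open>4 * m + 6\<close> gives
      \<open>m * s + s / 2 - s\<^sup>2 / 4 \<le> - s\<close>, and \<open>1 - ln d\<close> gives
      \<open>exp (- s) < d\<close>.\<close>
    define s where "s = Max {1 - r, 4 * m + 6, 1 - ln d}"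
    have s: "- r < s" "4 * m + 6 \<le> s" "- ln d < s" "0 < s"
    proof -
      have "1 - r \<le> s" "4 * m + 6 \<le> s" "1 - ln d \<le> s" unfolding s_def by (rule Max_ge; simp)+
      then show "- r < s" "4 * m + 6 \<le> s" "- ln d < s" "0 < s" using m by auto
    qed
    have "exp (m * ln s - s\<^sup>2 / 4) * ((m / - s - - s / 2) + 1) \<le> exp (m * s - s\<^sup>2 / 4) * exp (s / 2)"
    proof (intro mult_mono)
      have "ln s \<le> s" using ln_le_minus_one[OF s(4)] by simp
      then show "exp (m * ln s - s\<^sup>2 / 4) \<le> exp (m * s - s\<^sup>2 / 4)" using m by simp
      have "0 \<le> m / s" using m s by simp
      moreover have "(m / - s - - s / 2) + 1 = s / 2 - m / s + 1" by simp
      ultimately show "(m / - s - - s / 2) + 1 \<le> exp (s / 2)"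
        using exp_ge_add_one_self[of "s / 2"] by linarith
      have "m / s \<le> 1" using s m by (simp add: field_simps)
      moreover have "(m / - s - - s / 2) + 1 = s / 2 - m / s + 1" by simp
      ultimately show "0 \<le> (m / - s - - s / 2) + 1" using s by linarith
    qed simp
    also have "\<dots> = exp (m * s + s / 2 - s * s / 4)" by (simp add: power2_eq_square algebra_simps flip: exp_add)
    also have "\<dots> \<le> exp (- s)"
    proof -
      have "s * (4 * m + 6) \<le> s * s" using s by (intro mult_left_mono) auto
      then show ?thesis by (simp add: algebra_simps)
    qed
    also have "\<dots> < exp (ln d)" using s(3) by simp
    also have "\<dots> = d" using \<open>0 < d\<close> by simp
    finally show ?thesis using s(1) that(1) by (intro bexI[of _ "- s"]) auto
  qed
  show ?thesis
  proof
    show "open ({..r_L1 n} - {r_L1 n})"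
    proof -
      have "{..r_L1 n} - {r_L1 n} = {..<r_L1 n}" by auto
      then show ?thesis by simp
    qed
    show "continuous_on {..r_L1 n} (\<lambda>r. 1 / 2 + m / r\<^sup>2)"
      using e_neg by (intro continuous_intros) auto
    fix r assume "r \<in> {..r_L1 n}"
    then have r: "r \<le> r_L1 n" "r < 0" using e_neg by auto
    note r2 = le[OF r(1)]
    show "0 < m / r - r / 2"
    proof -
      have "m / r - r / 2 = (r\<^sup>2 - 2 * m) / (2 * - r)" using r by (simp add: field_simps power2_eq_square)
      moreover have "0 < (r\<^sup>2 - 2 * m) / (2 * - r)" using r r2 w by (intro divide_pos_pos) auto
      ultimately show ?thesis by simp
    qed
    show "((\<lambda>r. m / r - r / 2) has_real_derivative - (1 / 2 + m / r\<^sup>2)) (at r)"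
      using r by (auto intro!: derivative_eq_intros simp: field_simps power2_eq_square)
    show "0 < 1 / 2 + m / r\<^sup>2" using m by (intro add_pos_nonneg) auto
    have "0 \<le> ((r\<^sup>2 - (2 * m + 1))\<^sup>2 - (8 * m + 1)) / (4 * r\<^sup>2)"
      using power_mono[of w "r\<^sup>2 - (2 * m + 1)" 2] r2 w by simp
    then show "1 / 2 + m / r\<^sup>2 \<le> (m / r - r / 2)\<^sup>2" using shrinker_slope_identity[of r m] r by simp
    show "((\<lambda>r. exp (m * ln (- 1 * r) - r\<^sup>2 / 4)) has_real_derivative
        (m / r - r / 2) * exp (m * ln (- 1 * r) - r\<^sup>2 / 4)) (at r)"
      by (rule exp_ln_deriv) (use r in auto)
    assume "r < r_L1 n"
    note r2' = less[OF this]
    have "0 < ((r\<^sup>2 - (2 * m + 1))\<^sup>2 - (8 * m + 1)) / (4 * r\<^sup>2)"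
      using power_strict_mono[of w "r\<^sup>2 - (2 * m + 1)" 2] r2' w r by simp
    then show "1 / 2 + m / r\<^sup>2 < (m / r - r / 2)\<^sup>2" using shrinker_slope_identity[of r m] r by simp
  qed (use e_neg small in \<open>auto simp: m_def\<close>)
qed

lemma shrinker_profile_positive:
  assumes n: "3 \<le> n" and e: "0 < e" "e \<le> r_1 n"
  defines "m \<equiv> real n - 1"
  shows "shrinker_profile (\<lambda>r. m / r - r / 2) (\<lambda>r. 1 / 2 + m / r\<^sup>2)
    (\<lambda>r. exp (m * ln (1 * r) - r\<^sup>2 / 4)) {0<..e} e n"
proof -
  have m: "2 \<le> m" using n by (simp add: m_def)
  define w where "w = sqrt (8 * m + 1)"
  have w: "1 < w" "w\<^sup>2 = 8 * m + 1" using m by (auto simp: w_def)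
  \<comment> \<open>\<open>4 * (2 n - 7/4) = 8 (n - 1) + 1\<close>, so the square of
    \<open>r_1 n\<close> is the smaller root \<open>2 m + 1 - w\<close>.\<close>
  have "sqrt (2 * real n - 7 / 4) = w / 2"
    by (rule real_sqrt_unique) (use w in \<open>auto simp: power_divide m_def\<close>)
  then have r1: "r_1 n = sqrt (2 * m + 1 - w)" by (simp add: r_1_def m_def algebra_simps)
  have w_le: "w \<le> 2 * m + 1" unfolding w_def
    by (rule real_le_lsqrt) (use m in \<open>auto simp: power2_eq_square algebra_simps\<close>)
  have le: "r\<^sup>2 \<le> 2 * m + 1 - w" if "0 < r" "r \<le> e" for r
  proof -
    have "r\<^sup>2 \<le> (r_1 n)\<^sup>2" using that e by (intro power_mono) auto
    then show ?thesis using w_le by (simp add: r1)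
  qed
  have less: "r\<^sup>2 < 2 * m + 1 - w" if "0 < r" "r < e" for r
  proof -
    have "r\<^sup>2 < (r_1 n)\<^sup>2" using that e by (intro power_strict_mono) auto
    then show ?thesis using w_le by (simp add: r1)
  qed
  have small: "\<exists>R\<in>{0<..e}. R < r \<and> exp (m * ln (1 * R) - R\<^sup>2 / 4) * ((m / R - R / 2) + 1) < d"
    if r: "r \<in> {0<..e}" and "0 < d" for r d
  proof -
    define q where "q = d / (m + 1)"
    have q: "0 < q" using m \<open>0 < d\<close> by (simp add: q_def)
    \<comment> \<open>Here \<open>n \<ge> 3\<close> enters: from \<open>m \<ge> 2\<close> and
      \<open>s \<le> 1\<close> follows \<open>F s \<le> s\<^sup>2\<close>, which beats the pole of
      \<open>b\<close> and leaves \<open>s * (m + 1)\<close>. For \<open>m = 1\<close> the product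
      would tend to \<open>1\<close> at the origin.\<close>
    define s where "s = Min {r / 2, 1, q / 2}"
    have s: "0 < s" "s < r" "s \<le> 1" "s * (m + 1) < d"
    proof -
      have le: "s \<le> r / 2" "s \<le> 1" "s \<le> q / 2" unfolding s_def by (rule Min_le; simp)+
      have "0 < s" unfolding s_def using r q by (subst Min_gr_iff) auto
      moreover have "s < d / (m + 1)" unfolding q_def[symmetric] using le(3) q by linarith
      ultimately show "0 < s" "s < r" "s \<le> 1" "s * (m + 1) < d"
        using le r m by (auto simp: pos_less_divide_eq)
    qed
    have "exp (m * ln s - s\<^sup>2 / 4) * ((m / s - s / 2) + 1) \<le> s\<^sup>2 * ((m + 1) / s)"
    proof (intro mult_mono)
      have "m * ln s \<le> 2 * ln s" using m s by (intro mult_right_mono_neg) auto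
      moreover have "0 \<le> s\<^sup>2 / 4" by simp
      ultimately have "exp (m * ln s - s\<^sup>2 / 4) \<le> exp (2 * ln s)" unfolding exp_le_cancel_iff by linarith
      also have "\<dots> = s\<^sup>2" using s by (simp add: exp_double)
      finally show "exp (m * ln s - s\<^sup>2 / 4) \<le> s\<^sup>2" .
      have "1 \<le> 1 / s" using s by simp
      then show "(m / s - s / 2) + 1 \<le> (m + 1) / s" using s(1) unfolding add_divide_distrib by linarith
      have "m \<le> m / s" using s m by (simp add: field_simps mult_left_le)
      then show "0 \<le> (m / s - s / 2) + 1" using s m by simp
    qed simp
    also have "\<dots> = s * (m + 1)" using s by (simp add: power2_eq_square)
    also have "\<dots> < d" by (rule s(4))
    finally show ?thesis using s r by (intro bexI[of _ s]) auto
  qed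
  show ?thesis
  proof
    show "open ({0<..e} - {e})"
    proof -
      have "{0<..e} - {e} = {0<..<e}" by auto
      then show ?thesis by simp
    qed
    show "continuous_on {0<..e} (\<lambda>r. 1 / 2 + m / r\<^sup>2)" by (intro continuous_intros) auto
    fix r assume "r \<in> {0<..e}"
    then have r: "0 < r" "r \<le> e" by auto
    note r2 = le[OF r]
    show "0 < m / r - r / 2"
    proof -
      have "m / r - r / 2 = (2 * m - r\<^sup>2) / (2 * r)" using r by (simp add: field_simps power2_eq_square)
      then show ?thesis using r r2 w by simp
    qed
    show "((\<lambda>r. m / r - r / 2) has_real_derivative - (1 / 2 + m / r\<^sup>2)) (at r)"
      using r by (auto intro!: derivative_eq_intros simp: field_simps power2_eq_square)
    show "0 < 1 / 2 + m / r\<^sup>2" using m by (intro add_pos_nonneg) auto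
    have "0 \<le> ((r\<^sup>2 - (2 * m + 1))\<^sup>2 - (8 * m + 1)) / (4 * r\<^sup>2)"
      using power_mono[of w "(2 * m + 1) - r\<^sup>2" 2] r2 w by (simp add: power2_commute)
    then show "1 / 2 + m / r\<^sup>2 \<le> (m / r - r / 2)\<^sup>2" using shrinker_slope_identity[of r m] r by simp
    show "((\<lambda>r. exp (m * ln (1 * r) - r\<^sup>2 / 4)) has_real_derivative
        (m / r - r / 2) * exp (m * ln (1 * r) - r\<^sup>2 / 4)) (at r)"
      by (rule exp_ln_deriv) (use r in auto)
    assume "r < e"
    note r2' = less[OF r(1) this]
    have "0 < ((r\<^sup>2 - (2 * m + 1))\<^sup>2 - (8 * m + 1)) / (4 * r\<^sup>2)"
      using power_strict_mono[of w "(2 * m + 1) - r\<^sup>2" 2] r2' w r by (simp add: power2_commute)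
    then show "1 / 2 + m / r\<^sup>2 < (m / r - r / 2)\<^sup>2" using shrinker_slope_identity[of r m] r by simp
  qed (use e small in \<open>auto simp: m_def\<close>)
qed

section \<open>Position of the two lines, and both halves of the theorem\<close>

text \<open>Both bounds compare radicands and use \<open>w \<ge> 1\<close>. The first one places all
  radii left of the line inside the domain of starting points.\<close>

lemma r_L1_less:
  assumes "2 \<le> n"
  shows "r_L1 n \<le> - sqrt (2 * real n)" "r_L1 n < - sqrt (2 * (real n - 1))"
proof -
  define w where "w = sqrt (8 * (real n - 1) + 1)"
  have "1 \<le> w" unfolding w_def using assms by simp
  then show "r_L1 n \<le> - sqrt (2 * real n)" "r_L1 n < - sqrt (2 * (real n - 1))"
    unfolding r_L1_def neg_less_iff_less neg_le_iff_le w_def[symmetric] by simp_all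
qed

lemma r_L2_bounds:
  assumes n: "3 \<le> n"
  shows "0 < r_L2 n" "r_L2 n \<le> r_1 n" "r_L2 n < sqrt (2 * (real n - 1))"
proof -
  have n': "3 \<le> real n" using n by simp
  \<comment> \<open>The difference of the squares is \<open>(n - 1) (n - 2)\<close>.\<close>
  have s: "sqrt (2 * real n - 7 / 4) < real n - 1 / 2"
  proof (rule real_less_lsqrt)
    have "0 < (real n - 1) * (real n - 2)" using n' by simp
    then show "2 * real n - 7 / 4 < (real n - 1 / 2)\<^sup>2" by (simp add: power2_eq_square algebra_simps)
  qed (use n' in simp_all)
  have "0 < r_1 n" unfolding r_1_def using s by simp
  moreover have "0 < r_3 n" unfolding r_3_def using n' by simp
  moreover have "0 < r_2 n"
  proof -
    \<comment> \<open>In terms of \<open>c \<ge> 1\<close> the radicand of \<open>r_2 n\<close> is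
      \<open>2 (n - 1) (c - sqrt (c\<^sup>2 - 1))\<close>, whose sign is visible.\<close>
    define c where "c = (4 * real n - 5) / (4 * real n - 6)"
    have "1 \<le> c" using n' by (simp add: c_def field_simps)
    have "sqrt (c\<^sup>2 - 1) < c" using \<open>1 \<le> c\<close> by (intro real_less_lsqrt) auto
    then have "0 < 2 * ((real n - 1) * (c - sqrt (c\<^sup>2 - 1)))" using n' by simp
    also have "2 * ((real n - 1) * (c - sqrt (c\<^sup>2 - 1))) =
        2 * ((real n - 1) * (4 * real n - 5) / (2 * (2 * real n - 3)) - (real n - 1) * sqrt (c\<^sup>2 - 1))"
      using n' by (simp add: c_def algebra_simps)
    finally show ?thesis unfolding r_2_def c_def by simp
  qed
  ultimately show "0 < r_L2 n" by (simp add: r_L2_def)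
  show le: "r_L2 n \<le> r_1 n" by (simp add: r_L2_def)
  have "1 / 2 < sqrt (2 * real n - 7 / 4)"
    by (rule real_less_rsqrt) (use n' in \<open>simp add: power2_eq_square\<close>)
  then have "r_1 n < sqrt (2 * (real n - 1))" unfolding r_1_def by (intro real_sqrt_less_mono) simp
  with le show "r_L2 n < sqrt (2 * (real n - 1))" by simp
qed

theorem theorem4:
  fixes n :: nat and C :: ereal
  assumes "2 \<le> n" and "0 < C"
  shows
    "(r_L1 n < - sqrt (2 * (real n - 1)) \<and>
      (\<forall>R\<in>L1_dom n. \<forall>\<rho> h. horizontal_point n C R (\<rho>, h) \<longrightarrow> \<rho> < r_L1 n \<longrightarrow>
         monotone_increasing_at n C (L1_dom n) R) \<and>
      (\<exists>!P. P \<in> horizontal_curve n C (L1_dom n) \<and> fst P = r_L1 n)) \<and>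
     (3 \<le> n \<longrightarrow>
      0 < r_L2 n \<and> r_L2 n < sqrt (2 * (real n - 1)) \<and>
      (\<forall>R\<in>L2_dom n. \<forall>\<rho> h. horizontal_point n C R (\<rho>, h) \<longrightarrow> 0 < \<rho> \<longrightarrow> \<rho> < r_L2 n \<longrightarrow>
         monotone_increasing_at n C (L2_dom n) R) \<and>
      (\<exists>!P. P \<in> horizontal_curve n C (L2_dom n) \<and> fst P = r_L2 n))"
proof (intro conjI impI ballI allI)
  note L1 = r_L1_less[OF \<open>2 \<le> n\<close>]
  show "r_L1 n < - sqrt (2 * (real n - 1))" by (rule L1)
  interpret neg: shrinker_profile "\<lambda>r. (real n - 1) / r - r / 2" "\<lambda>r. 1 / 2 + (real n - 1) / r\<^sup>2"
    "\<lambda>r. exp ((real n - 1) * ln (- 1 * r) - r\<^sup>2 / 4)" "{..r_L1 n}" "r_L1 n" n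
    by (rule shrinker_profile_negative[OF \<open>2 \<le> n\<close>])
  have sub: "{..r_L1 n} - {r_L1 n} \<subseteq> L1_dom n" using L1 by (auto simp: L1_dom_def)
  show "\<exists>!P. P \<in> horizontal_curve n C (L1_dom n) \<and> fst P = r_L1 n"
    by (rule neg.horizontal_curve_meets_line_once[OF \<open>0 < C\<close> sub]) simp
  show "monotone_increasing_at n C (L1_dom n) R"
    if "R \<in> L1_dom n" "horizontal_point n C R (\<rho>, h)" "\<rho> < r_L1 n" for R \<rho> h
  proof (rule neg.horizontal_curve_monotone_increasing[OF \<open>0 < C\<close> sub _ that(2,3)])
    show "R \<in> {..r_L1 n}" using that by (auto simp: horizontal_point_def)
  qed
next
  assume n: "3 \<le> n"
  note L2 = r_L2_bounds[OF n]
  show "0 < r_L2 n" "r_L2 n < sqrt (2 * (real n - 1))" by (rule L2)+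
  interpret pos: shrinker_profile "\<lambda>r. (real n - 1) / r - r / 2" "\<lambda>r. 1 / 2 + (real n - 1) / r\<^sup>2"
    "\<lambda>r. exp ((real n - 1) * ln (1 * r) - r\<^sup>2 / 4)" "{0<..r_L2 n}" "r_L2 n" n
    by (rule shrinker_profile_positive[OF n L2(1,2)])
  have sub: "{0<..r_L2 n} - {r_L2 n} \<subseteq> L2_dom n" using L2 by (auto simp: L2_dom_def)
  show "\<exists>!P. P \<in> horizontal_curve n C (L2_dom n) \<and> fst P = r_L2 n"
    by (rule pos.horizontal_curve_meets_line_once[OF \<open>0 < C\<close> sub]) (auto simp: L2_dom_def)
  show "monotone_increasing_at n C (L2_dom n) R"
    if "R \<in> L2_dom n" "horizontal_point n C R (\<rho>, h)" "\<rho> < r_L2 n" for R \<rho> h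
  proof (rule pos.horizontal_curve_monotone_increasing[OF \<open>0 < C\<close> sub _ that(2,3)])
    show "R \<in> {0<..r_L2 n}" using that by (auto simp: horizontal_point_def L2_dom_def)
  qed
qed

end
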